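(* Let $G$ be a finite simple graph on $\{1,\ldots,r\}$, $r\ge 1$, with no isolated vertex, and let $J=J(G)$ be its cover ideal. Then: (1) $\omega(J^{(2s)})=\delta(J)\cdot 2s$ for every $s\ge1$. (2) There exists $m_2\in\mathcal G(J)$ such that for some $m_1\in\mathcal G(J^{(2)})$ satisfying $\deg(m_1)=2\delta(J)$, we have $m_1m_2\in\mathcal G(J^{(3)})$. Let $e$ be the maximal degree of such an $m_2$. Then $$\omega(J^{(2s+1)})=\delta(J)\cdot 2s+e\quad\text{for every } s\ge\omega(J)-e.$$ (3) If $\delta(J)=\omega(J)$ or $\delta(J)=r/2$, then, with $e$ as in part (2), $e=\omega(J)$. In particular, $\omega(J^{(2s+1)})=\delta(J)\cdot 2s+\omega(J)$ for all $s\ge0$.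
   Context: The cover ideal of $G$ is $J(G)=\bigcap_{\{i,j\}\in E(G)}(x_i,x_j)\subseteq R=k[x_1,\ldots,x_r]$, $k$ a field, $R$ standard graded. The $n$-th symbolic power of an ideal $I$ is $I^{(n)}=\bigcap_{\mathfrak p\in\operatorname{Min}(I)}(I^nR_{\mathfrak p}\cap R)$, where $\operatorname{Min}(I)$ is the set of minimal primes; here $J(G)^{(n)}=\bigcap_{\{i,j\}\in E(G)}(x_i,x_j)^n$. For a monomial ideal $L$, $\mathcal G(L)$ is the set of its minimal monomial generators and $\omega(L)$ is the maximal degree of an element of $\mathcal G(L)$. Let $\mathcal{SP}(J(G))=\{\mathbf x\in\mathbb R^r : x_i\ge0 \text{ for all } i,\ x_i+x_j\ge1 \text{ for all } \{i,j\}\in E(G)\}$ and $\delta(J(G))=\max\{|\mathbf v| : \mathbf v\text{ is a vertex of }\mathcal{SP}(J(G))\}$, where $|\mathbf v|=v_1+\cdots+v_r$. *)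

theory Defs
  imports
    "HOL-Analysis.Analysis"
    "HOL-Library.Poly_Mapping"
    "HOL-Algebra.Ideal_Product"
    "HOL-Algebra.Algebraic_Closure_Type"
begin

section \<open>Symbolic powers of ideals in a commutative ring\<close>

definition minimal_primes :: "('a, 'b) ring_scheme \<Rightarrow> 'a set \<Rightarrow> 'a set set" where
  "minimal_primes R I = {P. primeideal P R \<and> I \<subseteq> P \<and>
     (\<forall>Q. primeideal Q R \<and> I \<subseteq> Q \<and> Q \<subseteq> P \<longrightarrow> Q = P)}"

text \<open>
  The contraction \<open>A R\<^sub>P \<inter> R\<close> of the extension of an ideal \<open>A\<close> to the localization at a prime \<open>P\<close>,
  with the localization unfolded: the elements of \<open>A R\<^sub>P\<close> are the fractions \<open>a / s\<close> with \<open>a \<in> A\<close> and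
  \<open>s \<notin> P\<close>, and \<open>f / 1 = a / s\<close> holds in \<open>R\<^sub>P\<close> iff \<open>u s f = u a\<close> for some \<open>u \<notin> P\<close>.
\<close>

definition local_contraction :: "('a, 'b) ring_scheme \<Rightarrow> 'a set \<Rightarrow> 'a set \<Rightarrow> 'a set" where
  "local_contraction R P A = {f \<in> carrier R.
     \<exists>a\<in>A. \<exists>s\<in>carrier R - P. \<exists>u\<in>carrier R - P. u \<otimes>\<^bsub>R\<^esub> (s \<otimes>\<^bsub>R\<^esub> f) = u \<otimes>\<^bsub>R\<^esub> a}"

text \<open>The ordinary power \<open>I\<^sup>n\<close> is the power in the multiplicative monoid of ideals.\<close>

definition symbolic_power :: "('a, 'b) ring_scheme \<Rightarrow> 'a set \<Rightarrow> nat \<Rightarrow> 'a set" where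
  "symbolic_power R I n =
     (\<Inter>P\<in>minimal_primes R I. local_contraction R P (I [^]\<^bsub>ideals_set R\<^esub> n))"


section \<open>The polynomial ring and its monomial ideals\<close>

text \<open>
  The polynomial ring over \<open>'k\<close> with one variable for each element of the finite type \<open>'v\<close>:
  finitely supported functions from exponent vectors to coefficients.
\<close>

type_synonym ('v, 'k) mpoly = "('v \<Rightarrow>\<^sub>0 nat) \<Rightarrow>\<^sub>0 'k"

abbreviation mpoly_ring :: "('v::finite, 'k::field) mpoly ring" where
  "mpoly_ring \<equiv> ring_of_type_algebra"

definition monomial :: "('v \<Rightarrow>\<^sub>0 nat) \<Rightarrow> ('v::finite, 'k::field) mpoly" where
  "monomial a = Poly_Mapping.single a 1"

definition var :: "'v \<Rightarrow> ('v::finite, 'k::field) mpoly" where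
  "var i = monomial (Poly_Mapping.single i 1)"

text \<open>Total degree in the standard grading, for nonzero polynomials.\<close>

definition total_degree :: "('v::finite, 'k::field) mpoly \<Rightarrow> nat" where
  "total_degree f = (MAX a\<in>Poly_Mapping.keys f. \<Sum>i\<in>UNIV. Poly_Mapping.lookup a i)"

definition minimal_monomial_generating_set ::
    "('v::finite, 'k::field) mpoly set \<Rightarrow> ('v, 'k) mpoly set \<Rightarrow> bool" where
  "minimal_monomial_generating_set L A \<longleftrightarrow>
     A \<subseteq> range monomial \<and> Idl\<^bsub>mpoly_ring\<^esub> A = L \<and> (\<forall>B. B \<subset> A \<longrightarrow> Idl\<^bsub>mpoly_ring\<^esub> B \<noteq> L)"

text \<open>
  A monomial ideal has exactly one minimal generating set consisting of monomials, so the
  description operator is meaningful for such ideals (and is only used for them).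
\<close>

definition min_gens :: "('v::finite, 'k::field) mpoly set \<Rightarrow> ('v, 'k) mpoly set" where
  "min_gens L = (THE A. minimal_monomial_generating_set L A)"

definition omega :: "('v::finite, 'k::field) mpoly set \<Rightarrow> nat" where
  "omega L = Max (total_degree ` min_gens L)"


section \<open>Cover ideals and symbolic polyhedra of graphs\<close>

text \<open>A graph on the vertex set \<open>'v\<close> is given by its set of edges, which are two-element sets.\<close>

definition simple_graph :: "'v set set \<Rightarrow> bool" where
  "simple_graph E \<longleftrightarrow> (\<forall>e\<in>E. card e = 2)"

definition no_isolated_vertex :: "'v set set \<Rightarrow> bool" where
  "no_isolated_vertex E \<longleftrightarrow> (\<forall>v. \<exists>e\<in>E. v \<in> e)"

definition cover_ideal :: "'v::finite set set \<Rightarrow> ('v, 'k::field) mpoly set" where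
  "cover_ideal E = (\<Inter>e\<in>E. Idl\<^bsub>mpoly_ring\<^esub> (var ` e))"

definition symbolic_polyhedron :: "'v::finite set set \<Rightarrow> (real ^ 'v) set" where
  "symbolic_polyhedron E =
     {x. (\<forall>i. x $ i \<ge> 0) \<and> (\<forall>i j. {i, j} \<in> E \<longrightarrow> x $ i + x $ j \<ge> 1)}"

text \<open>The vertices of a polyhedron are its extreme points.\<close>

definition delta :: "'v::finite set set \<Rightarrow> real" where
  "delta E = Max ((\<lambda>x. \<Sum>i\<in>UNIV. x $ i) ` {x. x extreme_point_of symbolic_polyhedron E})"

end

theory Submission
  imports Defs
begin

text \<open>
  Exponent vectors of monomials turn the theorem into one about covers. The minimal primes of the
  cover ideal \<open>J\<close> are generated by the edges, and localizing at such a prime makes all other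
  variables invertible, so the \<open>n\<close>-th symbolic power is spanned by the monomials whose exponent \<open>a\<close>
  satisfies \<open>a i + a j \<ge> n\<close> on all edges (\<open>symbolic_power_cover_ideal\<close>). Its minimal generators are
  the minimal such \<open>n\<close>-covers, and a cover is minimal iff every vertex lies on a tight edge, one
  where equality holds.

  Tight edges control sums: \<open>a + b\<close> is minimal iff at every vertex the covers \<open>a\<close> and \<open>b\<close> have a
  common tight edge (\<open>tight_covers_add_iff\<close>). Rounding the values of a minimal \<open>n\<close>-cover with
  \<open>n \<ge> 2\<close> to 0, 1 and 2 splits off a minimal 2-cover and leaves a minimal \<open>(n - 2)\<close>-cover, both with
  all tight edges of the original (\<open>tight_covers_split\<close>). Hence a minimal \<open>2s\<close>-cover is a sum of \<open>s\<close>
  minimal 2-covers, and multiples of a single 2-cover are minimal again, which gives the even case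
  once \<open>2 \<delta>\<close> is known to be the maximal degree \<open>D\<close> of a minimal 2-cover. This is \<open>delta_eq\<close>:
  vertices of the polyhedron are half-integral, and a minimal 2-cover divided by 2 lies on a compact
  face, where the maximum of a linear function is attained at a vertex (Krein-Milman).

  A minimal \<open>(2s+1)\<close>-cover is a sum of \<open>s\<close> minimal 2-covers and a minimal 1-cover \<open>c\<close>. If one of the
  2-covers has degree \<open>D\<close>, then its sum with \<open>c\<close> is minimal because they share tight edges, so \<open>c\<close>
  is counted by \<open>e\<close> and the degree is at most \<open>s D + e\<close>. Otherwise each 2-cover loses at least 1 and
  the degree is at most \<open>s (D - 1) + \<omega>(J)\<close>, which is no larger when \<open>s \<ge> \<omega>(J) - e\<close>. The value
  \<open>s D + e\<close> is attained by adding copies of a 2-cover of degree \<open>D\<close> to a compatible 1-cover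
  (\<open>max_degree_odd\<close>). If \<open>D\<close> is \<open>2 \<omega>(J)\<close> or the number of vertices, a
  1-cover of maximal degree is itself compatible, with its own double or with the all-ones 2-cover,
  so \<open>e = \<omega>(J)\<close>.
\<close>

section \<open>Ideals spanned by monomials\<close>

lemma ring_of_type_algebra_simps [simp]:
  "carrier ring_of_type_algebra = UNIV"
  "x \<otimes>\<^bsub>ring_of_type_algebra\<^esub> y = x * y"
  "x \<oplus>\<^bsub>ring_of_type_algebra\<^esub> y = x + y"
  "\<zero>\<^bsub>ring_of_type_algebra\<^esub> = 0"
  "\<one>\<^bsub>ring_of_type_algebra\<^esub> = 1"
  by (simp_all add: ring_of_type_algebra_def)

lemma ideal_type_algebra_iff:
  fixes I :: "'a::comm_ring_1 set"
  shows "ideal I ring_of_type_algebra \<longleftrightarrow>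
    0 \<in> I \<and> (\<forall>a\<in>I. \<forall>b\<in>I. a + b \<in> I) \<and> (\<forall>a\<in>I. \<forall>x. x * a \<in> I)"
    (is "?L \<longleftrightarrow> ?R")
proof
  assume ?L
  then interpret ideal I "ring_of_type_algebra :: 'a ring" .
  show ?R
    using I_l_closed additive_subgroup.a_closed[OF is_additive_subgroup]
      additive_subgroup.zero_closed[OF is_additive_subgroup] by auto
next
  assume R: ?R
  let ?A = "ring_of_type_algebra :: 'a ring"
  interpret A: cring ?A
    by (rule cring_from_type_algebra)
  show ?L
  proof (rule idealI)
    show "ring ?A"
      by (rule ring_from_type_algebra)
    have "\<ominus>\<^bsub>?A\<^esub> a \<in> I" if "a \<in> I" for a
    proof -
      have "\<ominus>\<^bsub>?A\<^esub> a = - a"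
        by (rule A.minus_equality) auto
      then show ?thesis
        using R that by (metis mult_minus1)
    qed
    then show "subgroup I (add_monoid ?A)"
      using R by (intro A.add.subgroupI) (auto simp: a_inv_def)
  qed (use R in \<open>auto simp: mult.commute\<close>)
qed

lemma ideal_sum_closed:
  fixes I :: "'a::comm_ring_1 set"
  assumes "ideal I ring_of_type_algebra" "\<And>x. x \<in> G \<Longrightarrow> f x \<in> I"
  shows "sum f G \<in> I"
  using assms(2)
  by (induction G rule: infinite_finite_induct)
    (use assms(1) in \<open>auto simp: ideal_type_algebra_iff\<close>)

definition up_closure :: "('v \<Rightarrow>\<^sub>0 nat) set \<Rightarrow> ('v \<Rightarrow>\<^sub>0 nat) set" where
  "up_closure G = {a + c | a c. a \<in> G}"

definition monomial_span :: "('v \<Rightarrow>\<^sub>0 nat) set \<Rightarrow> ('v::finite, 'k::field) mpoly set" where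
  "monomial_span U = {f. Poly_Mapping.keys f \<subseteq> U}"

lemma monomial_mult: "monomial a * monomial b = monomial (a + b)"
  by (simp add: monomial_def mult_single)

lemma keys_monomial [simp]:
  "Poly_Mapping.keys (monomial a :: ('v::finite, 'k::field) mpoly) = {a}"
  by (simp add: monomial_def)

lemma monomial_eq_iff [simp]:
  "(monomial a :: ('v::finite, 'k::field) mpoly) = monomial b \<longleftrightarrow> a = b"
  by (metis keys_monomial singleton_inject)

lemma monomial_in_span [simp]: "monomial a \<in> monomial_span U \<longleftrightarrow> a \<in> U"
  by (simp add: monomial_span_def)

lemma subset_up_closure: "G \<subseteq> up_closure G"
  unfolding up_closure_def by (force intro: exI[of _ 0])

lemma up_closure_idem [simp]: "up_closure (up_closure G) = up_closure G"
proof
  show "up_closure (up_closure G) \<subseteq> up_closure G"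
    unfolding up_closure_def by clarsimp (metis add.assoc)
qed (rule subset_up_closure)

lemma ideal_monomial_span:
  assumes "up_closure U = U"
  shows "ideal (monomial_span U :: ('v::finite, 'k::field) mpoly set) mpoly_ring"
  unfolding ideal_type_algebra_iff
proof (intro conjI ballI allI)
  show "(0 :: ('v, 'k) mpoly) \<in> monomial_span U"
    by (simp add: monomial_span_def)
next
  fix f g :: "('v, 'k) mpoly"
  assume "f \<in> monomial_span U" "g \<in> monomial_span U"
  then show "f + g \<in> monomial_span U"
    using keys_add[of f g] by (auto simp: monomial_span_def)
next
  fix f g :: "('v, 'k) mpoly"
  assume f: "f \<in> monomial_span U"
  have "a + b \<in> U" if "b \<in> Poly_Mapping.keys f" for a b
  proof -
    have "b + a \<in> up_closure U"
      using f that by (auto simp: monomial_span_def up_closure_def)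
    then show ?thesis
      using assms by (simp add: add.commute)
  qed
  then show "g * f \<in> monomial_span U"
    using keys_mult[of g f] by (auto simp: monomial_span_def)
qed

lemma mpoly_eq_sum_single:
  fixes f :: "('v::finite, 'k::field) mpoly"
  shows "f = (\<Sum>a\<in>Poly_Mapping.keys f. Poly_Mapping.single a (Poly_Mapping.lookup f a))"
    (is "f = ?S")
proof (rule poly_mapping_eqI)
  fix b
  have "Poly_Mapping.lookup ?S b =
      (\<Sum>a\<in>Poly_Mapping.keys f. if a = b then Poly_Mapping.lookup f a else 0)"
    unfolding lookup_sum by (intro sum.cong) (auto simp: lookup_single when_def)
  also have "\<dots> = Poly_Mapping.lookup f b"
    by (simp add: sum.delta not_in_keys_iff_lookup_eq_zero)
  finally show "Poly_Mapping.lookup f b = Poly_Mapping.lookup ?S b"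
    by simp
qed

lemma mult_mem_ideal_if_monomials:
  fixes f g :: "('v::finite, 'k::field) mpoly"
  assumes "ideal I mpoly_ring" "\<And>a. a \<in> Poly_Mapping.keys f \<Longrightarrow> g * monomial a \<in> I"
  shows "g * f \<in> I"
proof -
  have "g * f = (\<Sum>a\<in>Poly_Mapping.keys f. g * Poly_Mapping.single a (Poly_Mapping.lookup f a))"
    by (subst mpoly_eq_sum_single[of f]) (rule sum_distrib_left)
  also have "\<dots> = (\<Sum>a\<in>Poly_Mapping.keys f.
      Poly_Mapping.single 0 (Poly_Mapping.lookup f a) * (g * monomial a))"
    by (intro sum.cong) (simp_all add: monomial_def mult_single mult.left_commute)
  also have "\<dots> \<in> I"
    using assms by (intro ideal_sum_closed) (auto simp: ideal_type_algebra_iff)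
  finally show ?thesis .
qed

lemma Idl_monomials:
  "Idl\<^bsub>mpoly_ring\<^esub> (monomial ` G) = (monomial_span (up_closure G) :: ('v::finite, 'k::field) mpoly set)"
proof
  interpret A: ring "mpoly_ring :: ('v, 'k) mpoly ring"
    by (rule ring_from_type_algebra)
  show "Idl\<^bsub>mpoly_ring\<^esub> (monomial ` G) \<subseteq> (monomial_span (up_closure G) :: ('v, 'k) mpoly set)"
    using subset_up_closure[of G] by (intro A.genideal_minimal ideal_monomial_span) auto
  show "(monomial_span (up_closure G) :: ('v, 'k) mpoly set) \<subseteq> Idl\<^bsub>mpoly_ring\<^esub> (monomial ` G)"
  proof
    fix f :: "('v, 'k) mpoly"
    assume f: "f \<in> monomial_span (up_closure G)"
    let ?I = "Idl\<^bsub>mpoly_ring\<^esub> (monomial ` G) :: ('v, 'k) mpoly set"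
    have I: "ideal ?I mpoly_ring"
      by (rule A.genideal_ideal) simp
    have "monomial a \<in> ?I" if "a \<in> G" for a
      using A.genideal_self[of "monomial ` G"] that by auto
    then have "monomial (a + c) \<in> ?I" if "a \<in> G" for a c
      using I that unfolding ideal_type_algebra_iff
      by (metis add.commute monomial_mult)
    then have "1 * monomial a \<in> ?I" if "a \<in> Poly_Mapping.keys f" for a
      using f that by (auto simp: monomial_span_def up_closure_def)
    from mult_mem_ideal_if_monomials[OF I this] show "f \<in> ?I"
      by simp
  qed
qed

section \<open>Minimal monomial generators\<close>

definition divides_exp :: "('v \<Rightarrow>\<^sub>0 nat) \<Rightarrow> ('v \<Rightarrow>\<^sub>0 nat) \<Rightarrow> bool" where
  "divides_exp a b \<longleftrightarrow> (\<forall>i. Poly_Mapping.lookup a i \<le> Poly_Mapping.lookup b i)"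

definition minimal_exps :: "('v \<Rightarrow>\<^sub>0 nat) set \<Rightarrow> ('v \<Rightarrow>\<^sub>0 nat) set" where
  "minimal_exps U = {a \<in> U. \<forall>b\<in>U. divides_exp b a \<longrightarrow> b = a}"

lemma divides_exp_iff: "divides_exp a b \<longleftrightarrow> (\<exists>c. b = a + c)"
proof
  assume "divides_exp a b"
  then have "b = a + (b - a)"
    by (intro poly_mapping_eqI) (simp add: divides_exp_def lookup_add lookup_minus)
  then show "\<exists>c. b = a + c" ..
qed (auto simp: divides_exp_def lookup_add)

lemma up_closure_iff: "b \<in> up_closure G \<longleftrightarrow> (\<exists>a\<in>G. divides_exp a b)"
  by (auto simp: up_closure_def divides_exp_iff)

text \<open>A proper divisor has smaller degree, so descending from an exponent reaches a minimal one.\<close>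

lemma up_closure_minimal_exps:
  fixes U :: "('v::finite \<Rightarrow>\<^sub>0 nat) set"
  assumes "up_closure U = U"
  shows "up_closure (minimal_exps U) = U"
proof
  show "up_closure (minimal_exps U) \<subseteq> U"
    using assms by (auto simp: up_closure_def minimal_exps_def)
  show "U \<subseteq> up_closure (minimal_exps U)"
  proof
    fix a assume "a \<in> U"
    then show "a \<in> up_closure (minimal_exps U)"
    proof (induction "\<Sum>i\<in>UNIV. Poly_Mapping.lookup a i" arbitrary: a rule: less_induct)
      case less
      show ?case
      proof (cases "a \<in> minimal_exps U")
        case True
        then show ?thesis
          using subset_up_closure by auto
      next
        case False
        then obtain b where b: "b \<in> U" "divides_exp b a" "b \<noteq> a"
          using less.prems by (auto simp: minimal_exps_def)
        then obtain i where "Poly_Mapping.lookup b i \<noteq> Poly_Mapping.lookup a i"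
          using poly_mapping_eqI[of b a] by metis
        with b(2) have "Poly_Mapping.lookup b i < Poly_Mapping.lookup a i"
          by (simp add: divides_exp_def le_neq_trans)
        with b(2) have "(\<Sum>i\<in>UNIV. Poly_Mapping.lookup b i) < (\<Sum>i\<in>UNIV. Poly_Mapping.lookup a i)"
          by (intro sum_strict_mono_ex1) (auto simp: divides_exp_def)
        with b less.hyps have "b \<in> up_closure (minimal_exps U)"
          by blast
        with b(2) have "a \<in> up_closure (up_closure (minimal_exps U))"
          by (subst up_closure_iff) blast
        then show ?thesis
          by simp
      qed
    qed
  qed
qed

lemma minimal_exps_subset_generators:
  assumes "up_closure G = U"
  shows "minimal_exps U \<subseteq> G"
proof
  fix a assume a: "a \<in> minimal_exps U"
  with assms obtain b where "b \<in> G" "divides_exp b a"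
    by (auto simp: minimal_exps_def up_closure_iff)
  with a assms subset_up_closure[of G] show "a \<in> G"
    by (auto simp: minimal_exps_def)
qed

lemma monomial_span_eq_iff:
  "(monomial_span U :: ('v::finite, 'k::field) mpoly set) = monomial_span V \<longleftrightarrow> U = V"
  by (metis monomial_in_span subset_antisym subsetI)

text \<open>
  A generating set of monomials contains the monomials of all minimal exponents, since no other
  monomial of the ideal divides them; and these already generate.
\<close>

lemma min_gens_monomial_span:
  assumes U: "up_closure U = U"
  shows "min_gens (monomial_span U :: ('v::finite, 'k::field) mpoly set) = monomial ` minimal_exps U"
proof -
  let ?L = "monomial_span U :: ('v, 'k) mpoly set"
  have gen: "Idl\<^bsub>mpoly_ring\<^esub> (monomial ` G) = ?L \<longleftrightarrow> up_closure G = U" for G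
    by (simp add: Idl_monomials monomial_span_eq_iff)
  have generates: "Idl\<^bsub>mpoly_ring\<^esub> (monomial ` minimal_exps U) = ?L"
    by (simp add: gen up_closure_minimal_exps[OF U])
  have "minimal_monomial_generating_set ?L A \<longleftrightarrow> A = monomial ` minimal_exps U" for A
  proof
    assume A: "minimal_monomial_generating_set ?L A"
    then obtain G where G: "A = monomial ` G"
      by (auto simp: minimal_monomial_generating_set_def subset_image_iff)
    with A have "up_closure G = U"
      by (simp add: minimal_monomial_generating_set_def gen)
    then have "monomial ` minimal_exps U \<subseteq> A"
      using minimal_exps_subset_generators G by blast
    with generates show "A = monomial ` minimal_exps U"
      using A unfolding minimal_monomial_generating_set_def by (metis psubsetI)
  next
    assume A: "A = monomial ` minimal_exps U"
    have "Idl\<^bsub>mpoly_ring\<^esub> B \<noteq> ?L" if "B \<subset> A" for B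
    proof
      assume B: "Idl\<^bsub>mpoly_ring\<^esub> B = ?L"
      have "B \<subseteq> monomial ` minimal_exps U"
        using that A by blast
      then obtain G where G: "B = monomial ` G" "G \<subseteq> minimal_exps U"
        by (rule subset_imageE)
      with B have "up_closure G = U"
        by (simp add: gen)
      then have "minimal_exps U \<subseteq> G"
        by (rule minimal_exps_subset_generators)
      with G A that show False
        by blast
    qed
    then show "minimal_monomial_generating_set ?L A"
      using A generates by (auto simp: minimal_monomial_generating_set_def)
  qed
  then show ?thesis
    unfolding min_gens_def by (intro the_equality) blast+
qed

section \<open>Powers of primes generated by variables\<close>

definition weight :: "'v set \<Rightarrow> ('v \<Rightarrow>\<^sub>0 nat) \<Rightarrow> nat" where
  "weight e a = (\<Sum>k\<in>e. Poly_Mapping.lookup a k)"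

text \<open>
  This is the power \<open>P\<^sup>n\<close> of the prime \<open>P\<close> generated by the variables in \<open>e\<close>, described by the
  order of vanishing along \<open>P\<close>, since this is what localization at \<open>P\<close> detects.
\<close>

definition order_ideal :: "'v set \<Rightarrow> nat \<Rightarrow> ('v::finite, 'k::field) mpoly set" where
  "order_ideal e n = monomial_span {a. n \<le> weight e a}"

lemma weight_add: "weight e (a + b) = weight e a + weight e b"
  by (simp add: weight_def lookup_add sum.distrib)

lemma weight_single [simp]: "weight e (Poly_Mapping.single i n) = (if i \<in> e then n else 0)"
  for e :: "'v::finite set"
  by (simp add: weight_def lookup_single when_def)

lemma up_closure_cover_exps: "up_closure {a. \<forall>e\<in>E. n \<le> weight e a} = {a. \<forall>e\<in>E. n \<le> weight e a}"
proof
  show "up_closure {a. \<forall>e\<in>E. n \<le> weight e a} \<subseteq> {a. \<forall>e\<in>E. n \<le> weight e a}"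
    by (auto simp: up_closure_def weight_add intro: trans_le_add1)
qed (rule subset_up_closure)

lemma ideal_order_ideal: "ideal (order_ideal e n :: ('v::finite, 'k::field) mpoly set) mpoly_ring"
  unfolding order_ideal_def
  using ideal_monomial_span[OF up_closure_cover_exps[of "{e}" n]] by simp

lemma order_ideal_mult:
  assumes "f \<in> order_ideal e m" "g \<in> order_ideal e n"
  shows "f * g \<in> order_ideal e (m + n)"
  using assms keys_mult[of f g]
  by (fastforce simp: order_ideal_def monomial_span_def weight_add intro: add_mono)

text \<open>
  Among the elements of \<open>A\<close> and of \<open>B\<close>, keep only those with least coordinate at one index. A sum
  of two kept elements can only be reached from kept elements, so this can be repeated over all
  indices; in the end one sum \<open>a + b\<close> with a single representation is left.
\<close>

lemma unique_sum_on:
  fixes A B :: "('v \<Rightarrow>\<^sub>0 nat) set"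
  assumes "finite S" "finite A" "finite B" "A \<noteq> {}" "B \<noteq> {}"
  shows "\<exists>a\<in>A. \<exists>b\<in>B. \<forall>a'\<in>A. \<forall>b'\<in>B. a' + b' = a + b \<longrightarrow>
    (\<forall>i\<in>S. Poly_Mapping.lookup a' i = Poly_Mapping.lookup a i \<and>
            Poly_Mapping.lookup b' i = Poly_Mapping.lookup b i)"
  using assms
proof (induction S arbitrary: A B rule: finite_induct)
  case empty
  then show ?case by auto
next
  case (insert x S)
  define p where "p = Min ((\<lambda>a. Poly_Mapping.lookup a x) ` A)"
  define q where "q = Min ((\<lambda>b. Poly_Mapping.lookup b x) ` B)"
  define A0 where "A0 = {a \<in> A. Poly_Mapping.lookup a x = p}"
  define B0 where "B0 = {b \<in> B. Poly_Mapping.lookup b x = q}"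
  have pA: "p \<le> Poly_Mapping.lookup a x" if "a \<in> A" for a
    using that insert.prems by (simp add: p_def)
  have qB: "q \<le> Poly_Mapping.lookup b x" if "b \<in> B" for b
    using that insert.prems by (simp add: q_def)
  have "p \<in> (\<lambda>a. Poly_Mapping.lookup a x) ` A" "q \<in> (\<lambda>b. Poly_Mapping.lookup b x) ` B"
    unfolding p_def q_def using insert.prems by (auto intro!: Min_in)
  then have "A0 \<noteq> {}" "B0 \<noteq> {}"
    by (auto simp: A0_def B0_def)
  moreover have "finite A0" "finite B0"
    using insert.prems by (auto simp: A0_def B0_def)
  ultimately obtain a b where ab: "a \<in> A0" "b \<in> B0"
    and uniq: "\<And>a' b'. a' \<in> A0 \<Longrightarrow> b' \<in> B0 \<Longrightarrow> a' + b' = a + b \<Longrightarrow>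
      (\<forall>i\<in>S. Poly_Mapping.lookup a' i = Poly_Mapping.lookup a i \<and>
            Poly_Mapping.lookup b' i = Poly_Mapping.lookup b i)"
    using insert.IH[of A0 B0] by blast
  have "\<forall>i\<in>insert x S. Poly_Mapping.lookup a' i = Poly_Mapping.lookup a i \<and>
            Poly_Mapping.lookup b' i = Poly_Mapping.lookup b i"
    if "a' \<in> A" "b' \<in> B" "a' + b' = a + b" for a' b'
  proof -
    have "Poly_Mapping.lookup (a' + b') x = p + q"
      using that(3) ab by (simp add: lookup_add A0_def B0_def)
    then have "Poly_Mapping.lookup a' x = p" "Poly_Mapping.lookup b' x = q"
      using pA[OF that(1)] qB[OF that(2)] by (simp_all add: lookup_add)
    then have "a' \<in> A0" "b' \<in> B0"
      using that by (auto simp: A0_def B0_def)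
    from uniq[OF this that(3)] show ?thesis
      using \<open>a' \<in> A0\<close> \<open>b' \<in> B0\<close> ab by (auto simp: A0_def B0_def)
  qed
  moreover have "a \<in> A" "b \<in> B"
    using ab by (auto simp: A0_def B0_def)
  ultimately show ?case
    by blast
qed

text \<open>
  This replaces the leading term with respect to a monomial order: no linear order on the
  variables is given, but one uniquely represented sum is enough to see that a product of
  polynomials has a nonzero coefficient.
\<close>

lemma unique_sum:
  fixes A B :: "('v::finite \<Rightarrow>\<^sub>0 nat) set"
  assumes "finite A" "finite B" "A \<noteq> {}" "B \<noteq> {}"
  obtains a b where "a \<in> A" "b \<in> B"
    "\<And>a' b'. a' \<in> A \<Longrightarrow> b' \<in> B \<Longrightarrow> a' + b' = a + b \<Longrightarrow> a' = a \<and> b' = b"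
proof -
  obtain a b where ab: "a \<in> A" "b \<in> B"
    and uniq: "\<forall>a'\<in>A. \<forall>b'\<in>B. a' + b' = a + b \<longrightarrow>
      (\<forall>i\<in>UNIV. Poly_Mapping.lookup a' i = Poly_Mapping.lookup a i \<and>
            Poly_Mapping.lookup b' i = Poly_Mapping.lookup b i)"
    using unique_sum_on[of UNIV A B] assms by auto
  show thesis
  proof (rule that[OF ab])
    fix a' b'
    assume "a' \<in> A" "b' \<in> B" "a' + b' = a + b"
    with uniq have "\<forall>i. Poly_Mapping.lookup a' i = Poly_Mapping.lookup a i \<and>
            Poly_Mapping.lookup b' i = Poly_Mapping.lookup b i"
      by simp
    then show "a' = a \<and> b' = b"
      by (simp add: poly_mapping_eqI)
  qed
qed

lemma lookup_mult_unique_sum: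
  fixes f g :: "('v::finite, 'k::field) mpoly"
  assumes "a \<in> Poly_Mapping.keys f" "b \<in> Poly_Mapping.keys g"
    and uniq: "\<And>a' b'. a' \<in> Poly_Mapping.keys f \<Longrightarrow> b' \<in> Poly_Mapping.keys g \<Longrightarrow>
      a' + b' = a + b \<Longrightarrow> a' = a \<and> b' = b"
  shows "Poly_Mapping.lookup (f * g) (a + b) = Poly_Mapping.lookup f a * Poly_Mapping.lookup g b"
proof -
  let ?F = "Poly_Mapping.lookup f" and ?G = "Poly_Mapping.lookup g"
  have "f * g = (\<Sum>x\<in>Poly_Mapping.keys f. \<Sum>y\<in>Poly_Mapping.keys g.
      Poly_Mapping.single (x + y) (?F x * ?G y))"
    by (subst mpoly_eq_sum_single[of f], subst mpoly_eq_sum_single[of g])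
      (simp add: sum_product mult_single)
  then have "Poly_Mapping.lookup (f * g) (a + b) =
      (\<Sum>x\<in>Poly_Mapping.keys f. \<Sum>y\<in>Poly_Mapping.keys g.
        if x + y = a + b then ?F x * ?G y else 0)"
    by (simp add: lookup_sum lookup_single when_def)
  also have "\<dots> = (\<Sum>x\<in>Poly_Mapping.keys f. if x = a then
      (\<Sum>y\<in>Poly_Mapping.keys g. if y = b then ?F a * ?G b else 0) else 0)"
  proof (intro sum.cong refl)
    fix x assume x: "x \<in> Poly_Mapping.keys f"
    have "(\<Sum>y\<in>Poly_Mapping.keys g. if x + y = a + b then ?F x * ?G y else 0) =
        (\<Sum>y\<in>Poly_Mapping.keys g. if x = a \<and> y = b then ?F a * ?G b else 0)"
      using uniq x by (intro sum.cong) auto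
    then show "(\<Sum>y\<in>Poly_Mapping.keys g. if x + y = a + b then ?F x * ?G y else 0) =
        (if x = a then \<Sum>y\<in>Poly_Mapping.keys g. if y = b then ?F a * ?G b else 0 else 0)"
      by simp
  qed
  also have "\<dots> = ?F a * ?G b"
    using assms(1,2) by (simp add: sum.delta)
  finally show ?thesis .
qed

text \<open>
  Order of vanishing is additive. The parts of least order of the two factors have a uniquely
  represented sum of exponents; by minimality no other terms of the factors contribute to this
  exponent, so it survives in the product and has the order of \<open>f\<close>. The case \<open>n = 1\<close> says that
  the ideal is prime.
\<close>

lemma order_ideal_cancel:
  fixes f g :: "('v::finite, 'k::field) mpoly"
  assumes g: "g \<notin> order_ideal e 1" and gf: "g * f \<in> order_ideal e n"
  shows "f \<in> order_ideal e n"
proof (rule ccontr)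
  assume f: "f \<notin> order_ideal e n"
  define d where "d = Min (weight e ` Poly_Mapping.keys f)"
  define A where "A = {a \<in> Poly_Mapping.keys f. weight e a = d}"
  define B where "B = {b \<in> Poly_Mapping.keys g. weight e b = 0}"
  obtain a0 where a0: "a0 \<in> Poly_Mapping.keys f" "weight e a0 < n"
    using f by (fastforce simp: order_ideal_def monomial_span_def)
  have dmin: "d \<le> weight e a" if "a \<in> Poly_Mapping.keys f" for a
    using that by (simp add: d_def)
  then have "d < n"
    using a0 by (metis le_less_trans)
  have "d \<in> weight e ` Poly_Mapping.keys f"
    unfolding d_def using a0 by (intro Min_in) auto
  then have "A \<noteq> {}"
    by (auto simp: A_def)
  moreover have "B \<noteq> {}"
    using g by (auto simp: order_ideal_def monomial_span_def B_def)
  moreover have "finite A" "finite B"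
    by (auto simp: A_def B_def)
  ultimately obtain b a where ba: "b \<in> B" "a \<in> A"
    and uniq: "\<And>b' a'. b' \<in> B \<Longrightarrow> a' \<in> A \<Longrightarrow> b' + a' = b + a \<Longrightarrow> b' = b \<and> a' = a"
    by (metis unique_sum[of B A])
  have "Poly_Mapping.lookup (g * f) (b + a) = Poly_Mapping.lookup g b * Poly_Mapping.lookup f a"
  proof (rule lookup_mult_unique_sum)
    fix b' a'
    assume *: "b' \<in> Poly_Mapping.keys g" "a' \<in> Poly_Mapping.keys f" "b' + a' = b + a"
    have "weight e (b' + a') = d"
      using *(3) ba by (simp add: weight_add A_def B_def)
    then have "weight e a' = d" "weight e b' = 0"
      using dmin[OF *(2)] by (simp_all add: weight_add)
    with * show "b' = b \<and> a' = a"
      by (intro uniq) (auto simp: A_def B_def)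
  qed (use ba in \<open>auto simp: A_def B_def\<close>)
  then have "b + a \<in> Poly_Mapping.keys (g * f)"
    using ba by (simp add: in_keys_iff A_def B_def)
  then have "n \<le> weight e (b + a)"
    using gf by (auto simp: order_ideal_def monomial_span_def)
  with \<open>d < n\<close> ba show False
    by (simp add: weight_add A_def B_def)
qed

lemma monomial_in_order_ideal [simp]: "monomial a \<in> order_ideal e n \<longleftrightarrow> n \<le> weight e a"
  by (simp add: order_ideal_def)

lemma one_eq_monomial: "1 = monomial 0"
  by (simp add: monomial_def)

lemma primeideal_order_ideal:
  "primeideal (order_ideal e 1 :: ('v::finite, 'k::field) mpoly set) mpoly_ring"
proof (rule primeidealI)
  have "(1 :: ('v, 'k) mpoly) \<notin> order_ideal e 1"
    by (simp add: one_eq_monomial weight_def)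
  then show "carrier mpoly_ring \<noteq> (order_ideal e 1 :: ('v, 'k) mpoly set)"
    by auto
  show "cring (mpoly_ring :: ('v, 'k) mpoly ring)"
    by (rule cring_from_type_algebra)
  show "ideal (order_ideal e 1 :: ('v, 'k) mpoly set) mpoly_ring"
    by (rule ideal_order_ideal)
next
  fix f g :: "('v, 'k) mpoly"
  assume "f \<otimes>\<^bsub>mpoly_ring\<^esub> g \<in> order_ideal e 1"
  then show "f \<in> order_ideal e 1 \<or> g \<in> order_ideal e 1"
    using order_ideal_cancel[of f e g 1] by simp blast
qed

lemma var_image: "var ` e = monomial ` (\<lambda>i. Poly_Mapping.single i 1) ` e"
  by (auto simp: var_def)

lemma Idl_vars:
  "Idl\<^bsub>mpoly_ring\<^esub> (var ` e) = (order_ideal e 1 :: ('v::finite, 'k::field) mpoly set)"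
proof -
  have "(a \<in> up_closure ((\<lambda>i. Poly_Mapping.single i 1) ` e)) = (1 \<le> weight e a)"
    for a :: "'v \<Rightarrow>\<^sub>0 nat"
  proof -
    have "divides_exp (Poly_Mapping.single i 1) a \<longleftrightarrow> Poly_Mapping.lookup a i \<noteq> 0" for i
      by (auto simp: divides_exp_def lookup_single when_def Suc_le_eq)
    then have "(a \<in> up_closure ((\<lambda>i. Poly_Mapping.single i 1) ` e)) =
        (\<exists>i\<in>e. Poly_Mapping.lookup a i \<noteq> 0)"
      by (simp add: up_closure_iff)
    moreover have "weight e a \<noteq> 0 \<longleftrightarrow> (\<exists>i\<in>e. Poly_Mapping.lookup a i \<noteq> 0)"
      by (simp add: weight_def)
    ultimately show ?thesis
      by (simp add: Suc_le_eq)
  qed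
  then have "up_closure ((\<lambda>i. Poly_Mapping.single i 1) ` e) = {a. 1 \<le> weight e a}"
    by blast
  then show ?thesis
    by (simp only: var_image Idl_monomials order_ideal_def)
qed

section \<open>Symbolic powers of cover ideals\<close>

lemma cover_ideal_eq_Inter: "cover_ideal E = (\<Inter>e\<in>E. order_ideal e 1)"
  by (simp add: cover_ideal_def Idl_vars)

lemma Inter_order_ideal:
  "(\<Inter>e\<in>E. order_ideal e n) = monomial_span {a. \<forall>e\<in>E. n \<le> weight e a}"
  by (auto simp: order_ideal_def monomial_span_def)

lemma ideal_cover_ideal: "ideal (cover_ideal E :: ('v::finite, 'k::field) mpoly set) mpoly_ring"
  unfolding cover_ideal_eq_Inter Inter_order_ideal
  by (intro ideal_monomial_span up_closure_cover_exps)

lemma var_in_order_ideal: "var i \<in> order_ideal e 1 \<longleftrightarrow> i \<in> e"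
  by (simp add: var_def)

lemma order_ideal_1_subset_iff:
  "(order_ideal e 1 :: ('v::finite, 'k::field) mpoly set) \<subseteq> Q \<longleftrightarrow> var ` e \<subseteq> Q"
  if "ideal Q mpoly_ring"
proof -
  interpret A: ring "mpoly_ring :: ('v, 'k) mpoly ring"
    by (rule ring_from_type_algebra)
  show ?thesis
    using A.Idl_subset_ideal[OF that, of "var ` e"] by (simp add: Idl_vars)
qed

text \<open>
  If \<open>Q\<close> misses one variable from each member of \<open>E\<close>, the product of these variables lies in the
  cover ideal but not in the prime \<open>Q\<close>.
\<close>

lemma prime_over_cover_ideal:
  fixes Q :: "('v::finite, 'k::field) mpoly set"
  assumes Q: "primeideal Q mpoly_ring" and sub: "cover_ideal E \<subseteq> Q"
  obtains e where "e \<in> E" "order_ideal e 1 \<subseteq> Q"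
proof -
  interpret Q: primeideal Q mpoly_ring
    by (rule Q)
  have "\<exists>e\<in>E. var ` e \<subseteq> Q"
  proof (rule ccontr)
    assume "\<not> ?thesis"
    then have "\<forall>e\<in>E. \<exists>i\<in>e. var i \<notin> Q"
      by blast
    then obtain v where v: "\<And>e. e \<in> E \<Longrightarrow> v e \<in> e \<and> var (v e) \<notin> Q"
      by metis
    let ?p = "\<Prod>e\<in>E. (var (v e) :: ('v, 'k) mpoly)"
    have "(\<Prod>e\<in>F. (var (v e) :: ('v, 'k) mpoly)) \<notin> Q" if "finite F" "F \<subseteq> E" for F
      using that
    proof (induction F rule: finite_induct)
      case empty
      then show ?case
        using Q.one_imp_carrier Q.I_notcarr by auto
    next
      case (insert e F)
      then show ?case
        using v[of e] Q.I_prime by auto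
    qed
    then have "?p \<notin> Q"
      by simp
    moreover have "?p \<in> order_ideal e 1" if "e \<in> E" for e
    proof -
      have "?p = (\<Prod>e\<in>E - {e}. var (v e)) * var (v e)"
        using that by (simp add: prod.remove[of E e] mult.commute)
      moreover have "(var (v e) :: ('v, 'k) mpoly) \<in> order_ideal e 1"
        using v[OF that] by (simp only: var_in_order_ideal)
      ultimately show ?thesis
        using ideal_order_ideal[of e 1, where 'k = 'k] by (simp add: ideal_type_algebra_iff)
    qed
    ultimately show False
      using sub by (auto simp: cover_ideal_eq_Inter)
  qed
  then show thesis
    using that order_ideal_1_subset_iff[OF Q.is_ideal] by blast
qed

lemma minimal_primes_cover_ideal:
  assumes antichain: "\<And>e f. e \<in> E \<Longrightarrow> f \<in> E \<Longrightarrow> e \<subseteq> f \<Longrightarrow> e = f"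
  shows "minimal_primes mpoly_ring (cover_ideal E :: ('v::finite, 'k::field) mpoly set) =
    (\<lambda>e. order_ideal e 1) ` E"
proof (intro Set.set_eqI iffI)
  fix P :: "('v, 'k) mpoly set"
  assume P: "P \<in> minimal_primes mpoly_ring (cover_ideal E)"
  then obtain e where e: "e \<in> E" "order_ideal e 1 \<subseteq> P"
    unfolding minimal_primes_def using prime_over_cover_ideal by blast
  moreover have "cover_ideal E \<subseteq> (order_ideal e 1 :: ('v, 'k) mpoly set)"
    using e by (auto simp: cover_ideal_eq_Inter)
  ultimately have "order_ideal e 1 = P"
    using P primeideal_order_ideal unfolding minimal_primes_def by blast
  with e show "P \<in> (\<lambda>e. order_ideal e 1) ` E"
    by blast
next
  fix P :: "('v, 'k) mpoly set"
  assume "P \<in> (\<lambda>e. order_ideal e 1) ` E"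
  then obtain e where e: "e \<in> E" "P = order_ideal e 1"
    by blast
  have "Q = P" if Q: "primeideal Q mpoly_ring" "cover_ideal E \<subseteq> Q" "Q \<subseteq> P" for Q
  proof -
    obtain f where f: "f \<in> E" "order_ideal f 1 \<subseteq> Q"
      using Q prime_over_cover_ideal by blast
    have "var ` f \<subseteq> (order_ideal e 1 :: ('v, 'k) mpoly set)"
      using f(2) Q(3) e(2) order_ideal_1_subset_iff[OF ideal_order_ideal] by blast
    then have "f \<subseteq> e"
      unfolding image_subset_iff var_in_order_ideal by blast
    then have "f = e"
      using antichain e f by blast
    with f Q e show ?thesis
      by blast
  qed
  moreover have "cover_ideal E \<subseteq> P"
    using e by (auto simp: cover_ideal_eq_Inter)
  ultimately show "P \<in> minimal_primes mpoly_ring (cover_ideal E)"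
    using e primeideal_order_ideal by (simp add: minimal_primes_def)
qed

lemma ideals_set_simps [simp]:
  "\<one>\<^bsub>ideals_set R\<^esub> = carrier R"
  "I \<otimes>\<^bsub>ideals_set R\<^esub> K = ideal_prod R I K"
  by (simp_all add: ideals_set_def)

lemma (in ring) ideal_power_is_ideal:
  assumes "ideal I R"
  shows "ideal (I [^]\<^bsub>ideals_set R\<^esub> (n::nat)) R"
  by (induction n)
    (use assms in \<open>auto simp: oneideal ideal_prod_is_ideal\<close>)

lemma ideal_power_subset_order_ideal:
  fixes I :: "('v::finite, 'k::field) mpoly set"
  assumes "I \<subseteq> order_ideal e 1"
  shows "I [^]\<^bsub>ideals_set mpoly_ring\<^esub> n \<subseteq> order_ideal e n"
proof (induction n)
  case 0
  show ?case
    by (auto simp: order_ideal_def monomial_span_def)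
next
  case (Suc n)
  show ?case
  proof
    fix f
    assume "f \<in> I [^]\<^bsub>ideals_set mpoly_ring\<^esub> Suc n"
    then have "f \<in> ideal_prod mpoly_ring (I [^]\<^bsub>ideals_set mpoly_ring\<^esub> n) I"
      by (simp)
    then show "f \<in> order_ideal e (Suc n)"
    proof (induction rule: ideal_prod.induct)
      case (prod i j)
      then show ?case
        using order_ideal_mult[of i e n j 1] Suc.IH assms by auto
    next
      case (sum f g)
      then show ?case
        using ideal_order_ideal[of e "Suc n", where 'k = 'k] by (simp add: ideal_type_algebra_iff)
    qed
  qed
qed

text \<open>
  The exponent of the \<open>n\<close>-th power of the product of the variables outside \<open>e\<close>. This monomial is
  a unit after localizing at the prime of \<open>e\<close>, and serves as the denominator that carries \<open>P\<^sup>n\<close> into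
  the \<open>n\<close>-th power of the cover ideal.
\<close>

definition pad :: "'v::finite set \<Rightarrow> nat \<Rightarrow> ('v \<Rightarrow>\<^sub>0 nat)" where
  "pad e n = (\<Sum>k\<in>-e. Poly_Mapping.single k n)"

lemma lookup_pad: "Poly_Mapping.lookup (pad e n) i = (if i \<in> e then 0 else n)"
  by (simp add: pad_def lookup_sum lookup_single when_def)

text \<open>
  A variable in \<open>e\<close> times all variables outside \<open>e\<close> lies in the cover ideal, because each other
  member of the antichain has an element outside \<open>e\<close>. A monomial of order at least \<open>n\<close> along \<open>e\<close>
  supplies \<open>n\<close> such variables.
\<close>

lemma monomial_pad_in_power:
  fixes e :: "'v::finite set"
  assumes antichain: "\<And>f. f \<in> E \<Longrightarrow> f \<subseteq> e \<Longrightarrow> f = e"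
    and "n \<le> weight e a"
  shows "monomial (pad e n + a) \<in>
    (cover_ideal E :: ('v::finite, 'k::field) mpoly set) [^]\<^bsub>ideals_set mpoly_ring\<^esub> n"
  using assms(2)
proof (induction n arbitrary: a)
  case 0
  show ?case
    by (simp)
next
  case (Suc n)
  then have "weight e a \<noteq> 0"
    by simp
  then obtain i where i: "i \<in> e" "Poly_Mapping.lookup a i \<noteq> 0"
    by (auto simp: weight_def)
  then have "divides_exp (Poly_Mapping.single i 1) a"
    by (auto simp: divides_exp_def lookup_single when_def)
  then obtain b where b: "a = Poly_Mapping.single i 1 + b"
    by (auto simp: divides_exp_iff)
  have "n \<le> weight e b"
    using Suc.prems i by (simp add: b weight_add)
  then have IH: "monomial (pad e n + b) \<in>
      (cover_ideal E :: ('v, 'k) mpoly set) [^]\<^bsub>ideals_set mpoly_ring\<^esub> n"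
    by (rule Suc.IH)
  have "1 \<le> weight f (pad e 1 + Poly_Mapping.single i 1)" if f: "f \<in> E" for f
  proof (cases "f = e")
    case True
    then show ?thesis
      using i by (simp add: weight_add)
  next
    case False
    then obtain k where k: "k \<in> f" "k \<notin> e"
      using antichain f by blast
    then have "1 \<le> Poly_Mapping.lookup (pad e 1) k"
      by (simp add: lookup_pad)
    also have "\<dots> \<le> weight f (pad e 1)"
      unfolding weight_def using k by (intro member_le_sum) auto
    finally show ?thesis
      by (simp add: weight_add)
  qed
  then have J: "monomial (pad e 1 + Poly_Mapping.single i 1) \<in> (cover_ideal E :: ('v, 'k) mpoly set)"
    by (simp add: cover_ideal_eq_Inter)
  have "pad e (Suc n) + a = (pad e n + b) + (pad e 1 + Poly_Mapping.single i 1)"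
    by (intro poly_mapping_eqI) (simp add: b lookup_add lookup_pad)
  then have "monomial (pad e (Suc n) + a) = monomial (pad e n + b) \<otimes>\<^bsub>mpoly_ring\<^esub>
      (monomial (pad e 1 + Poly_Mapping.single i 1) :: ('v, 'k) mpoly)"
    by (simp add: monomial_mult)
  with IH J show ?case
    by (simp only: nat_pow_Suc ideals_set_simps ideal_prod.prod)
qed

text \<open>
  In one direction the power of the ideal has order at least \<open>n\<close>, and multipliers outside the
  prime can be cancelled; in the other the monomial with exponent \<open>pad e n\<close> is a denominator.
\<close>

lemma local_contraction_cover_ideal_power:
  fixes E :: "'v::finite set set"
  assumes antichain: "\<And>f. f \<in> E \<Longrightarrow> f \<subseteq> e \<Longrightarrow> f = e" and e: "e \<in> E"
  shows "local_contraction mpoly_ring (order_ideal e 1)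
      ((cover_ideal E :: ('v, 'k::field) mpoly set) [^]\<^bsub>ideals_set mpoly_ring\<^esub> n) = order_ideal e n"
    (is "local_contraction _ _ ?Jn = _")
proof (intro Set.set_eqI iffI)
  fix f :: "('v, 'k) mpoly"
  assume "f \<in> local_contraction mpoly_ring (order_ideal e 1) ?Jn"
  then obtain a s u where *: "a \<in> ?Jn" "s \<notin> order_ideal e 1" "u \<notin> order_ideal e 1"
      "u * (s * f) = u * a"
    by (auto simp: local_contraction_def)
  have "cover_ideal E \<subseteq> (order_ideal e 1 :: ('v, 'k) mpoly set)"
    using e by (auto simp: cover_ideal_eq_Inter)
  then have "a \<in> order_ideal e n"
    using ideal_power_subset_order_ideal *(1) by blast
  then have "u * (s * f) \<in> order_ideal e n"
    using *(4) ideal_order_ideal[of e n, where 'k = 'k] by (simp add: ideal_type_algebra_iff)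
  then show "f \<in> order_ideal e n"
    using * order_ideal_cancel by blast
next
  fix f :: "('v, 'k) mpoly"
  assume f: "f \<in> order_ideal e n"
  interpret A: ring "mpoly_ring :: ('v, 'k) mpoly ring"
    by (rule ring_from_type_algebra)
  have "ideal ?Jn mpoly_ring"
    by (intro A.ideal_power_is_ideal ideal_cover_ideal)
  moreover have "monomial (pad e n) * monomial a \<in> ?Jn" if "a \<in> Poly_Mapping.keys f" for a
    using f that monomial_pad_in_power[of E e n a] antichain
    by (auto simp: monomial_mult order_ideal_def monomial_span_def)
  ultimately have a: "monomial (pad e n) * f \<in> ?Jn"
    by (rule mult_mem_ideal_if_monomials)
  have s: "(monomial (pad e n) :: ('v, 'k) mpoly) \<notin> order_ideal e 1"
    by (simp add: weight_def lookup_pad)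
  have u: "(1 :: ('v, 'k) mpoly) \<notin> order_ideal e 1"
    by (simp add: one_eq_monomial weight_def)
  have "\<exists>a\<in>?Jn. \<exists>s\<in>carrier mpoly_ring - order_ideal e 1. \<exists>u\<in>carrier mpoly_ring - order_ideal e 1.
      u \<otimes>\<^bsub>mpoly_ring\<^esub> (s \<otimes>\<^bsub>mpoly_ring\<^esub> f) = u \<otimes>\<^bsub>mpoly_ring\<^esub> a"
    by (rule bexI[OF _ a], rule bexI[of _ "monomial (pad e n)"], rule bexI[of _ 1])
      (use s u in auto)
  then show "f \<in> local_contraction mpoly_ring (order_ideal e 1) ?Jn"
    by (simp add: local_contraction_def)
qed

lemma symbolic_power_cover_ideal:
  assumes "\<And>e f. e \<in> E \<Longrightarrow> f \<in> E \<Longrightarrow> e \<subseteq> f \<Longrightarrow> e = f"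
  shows "symbolic_power mpoly_ring (cover_ideal E :: ('v::finite, 'k::field) mpoly set) n =
    monomial_span {a. \<forall>e\<in>E. n \<le> weight e a}"
proof -
  have "symbolic_power mpoly_ring (cover_ideal E :: ('v, 'k) mpoly set) n =
      (\<Inter>e\<in>E. local_contraction mpoly_ring (order_ideal e 1)
        (cover_ideal E [^]\<^bsub>ideals_set mpoly_ring\<^esub> n))"
    unfolding symbolic_power_def by (subst minimal_primes_cover_ideal[OF assms]) simp_all
  also have "\<dots> = (\<Inter>e\<in>E. order_ideal e n)"
    using assms by (intro INF_cong refl local_contraction_cover_ideal_power) auto
  finally show ?thesis
    by (simp add: Inter_order_ideal)
qed

section \<open>Minimal covers of a graph\<close>

definition tight :: "'v set set \<Rightarrow> nat \<Rightarrow> ('v \<Rightarrow> nat) \<Rightarrow> 'v \<Rightarrow> 'v \<Rightarrow> bool" where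
  "tight E n a i j \<longleftrightarrow> {i, j} \<in> E \<and> a i + a j = n"

definition covers :: "'v set set \<Rightarrow> nat \<Rightarrow> ('v \<Rightarrow> nat) set" where
  "covers E n = {a. \<forall>i j. {i, j} \<in> E \<longrightarrow> n \<le> a i + a j}"

text \<open>
  For a graph without isolated vertices these are exactly the minimal covers, that is, the
  exponents of the minimal generators of the \<open>n\<close>-th symbolic power. The description by tight edges
  is preferred because it is local: it makes visible which sums of covers are again minimal.
\<close>

definition tight_covers :: "'v set set \<Rightarrow> nat \<Rightarrow> ('v \<Rightarrow> nat) set" where
  "tight_covers E n = {a \<in> covers E n. \<forall>i. \<exists>j. tight E n a i j}"

lemma coversD: "a \<in> covers E n \<Longrightarrow> {i, j} \<in> E \<Longrightarrow> n \<le> a i + a j"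
  by (simp add: covers_def)

lemma tight_covers_imp_covers: "a \<in> tight_covers E n \<Longrightarrow> a \<in> covers E n"
  by (simp add: tight_covers_def)

lemma simple_graph_neq: "simple_graph E \<Longrightarrow> {i, j} \<in> E \<Longrightarrow> i \<noteq> j"
  by (auto simp: simple_graph_def)

lemma simple_graph_edgeE:
  assumes "simple_graph E" "e \<in> E"
  obtains i j where "e = {i, j}" "i \<noteq> j"
  using assms by (auto simp: simple_graph_def card_2_iff)

lemma ex_neighbour:
  assumes "simple_graph E" "no_isolated_vertex E"
  obtains j where "{i, j} \<in> E"
proof -
  obtain e where e: "e \<in> E" "i \<in> e"
    using assms(2) by (auto simp: no_isolated_vertex_def)
  then obtain k l where "e = {k, l}"
    using assms(1) simple_graph_edgeE by metis
  with e that show thesis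
    by (auto simp: insert_commute)
qed

lemma tight_cover_le_imp_eq:
  assumes "a \<in> tight_covers E n" "b \<in> covers E n" "\<And>i. b i \<le> a i"
  shows "b = a"
proof
  fix i
  obtain j where "{i, j} \<in> E" "a i + a j = n"
    using assms(1) by (auto simp: tight_covers_def tight_def)
  then have "a i + a j \<le> b i + b j"
    using coversD[OF assms(2)] by simp
  then show "b i = a i"
    using assms(3)[of i] assms(3)[of j] by simp
qed

text \<open>
  A positive value can be lowered unless a tight edge prevents it. A vertex with value 0 has a
  neighbour with value at least \<open>n\<close>, and a tight edge at this neighbour forces the value \<open>n\<close>.
\<close>

lemma minimal_cover_imp_tight:
  assumes E: "simple_graph E" "no_isolated_vertex E" and a: "a \<in> covers E n"
    and minimal: "\<And>b. b \<in> covers E n \<Longrightarrow> (\<And>i. b i \<le> a i) \<Longrightarrow> b = a"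
  shows "a \<in> tight_covers E n"
proof -
  have pos: "\<exists>j. tight E n a i j" if "a i > 0" for i
  proof (rule ccontr)
    assume no: "\<nexists>j. tight E n a i j"
    define b where "b = a(i := a i - 1)"
    have "n \<le> b k + b l" if kl: "{k, l} \<in> E" for k l
    proof -
      have "n \<le> a k + a l" "k \<noteq> l"
        using coversD[OF a kl] simple_graph_neq[OF E(1) kl] by auto
      moreover have "a k + a l \<noteq> n" if "k = i \<or> l = i"
        using no that kl by (auto simp: tight_def insert_commute add.commute)
      ultimately show ?thesis
        by (auto simp: b_def)
    qed
    then have "b = a"
      by (intro minimal) (auto simp: covers_def b_def)
    then have "b i = a i"
      by simp
    with that show False
      by (simp add: b_def)
  qed
  have "\<exists>j. tight E n a i j" if i: "a i = 0" for i
  proof -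
    obtain j where j: "{i, j} \<in> E"
      using E by (rule ex_neighbour)
    then have n: "n \<le> a j"
      using coversD[OF a] i by fastforce
    have "a j = n"
    proof (cases "a j = 0")
      case False
      then obtain k where "tight E n a j k"
        using pos by auto
      then have "a j \<le> n"
        by (auto simp: tight_def)
      with n show ?thesis
        by simp
    qed (use n in auto)
    then show ?thesis
      using i j by (auto simp: tight_def)
  qed
  with pos a show ?thesis
    unfolding tight_covers_def by blast
qed

lemma tight_cover_le:
  assumes "a \<in> tight_covers E n"
  shows "a i \<le> n"
proof -
  obtain j where "tight E n a i j"
    using assms by (auto simp: tight_covers_def)
  then show ?thesis
    by (auto simp: tight_def)
qed

lemma finite_tight_covers: "finite (tight_covers E n :: ('v::finite \<Rightarrow> nat) set)"
proof (rule finite_subset)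
  show "tight_covers E n \<subseteq> (UNIV :: 'v set) \<rightarrow>\<^sub>E {..n}"
  proof
    fix a assume "a \<in> tight_covers E n"
    from tight_cover_le[OF this] show "a \<in> (UNIV :: 'v set) \<rightarrow>\<^sub>E {..n}"
      by (simp add: PiE_iff extensional_def)
  qed
  show "finite ((UNIV :: 'v set) \<rightarrow>\<^sub>E {..n})"
    by (intro finite_PiE) auto
qed

lemma covers_add:
  assumes "a \<in> covers E m" "b \<in> covers E n"
  shows "(\<lambda>i. a i + b i) \<in> covers E (m + n)"
proof -
  have "m + n \<le> (a i + b i) + (a j + b j)" if "{i, j} \<in> E" for i j
  proof -
    have "m \<le> a i + a j" "n \<le> b i + b j"
      using assms that by (simp_all add: coversD)
    then show ?thesis
      by simp
  qed
  then show ?thesis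
    by (simp add: covers_def)
qed

lemma tight_add_iff:
  assumes "a \<in> covers E m" "b \<in> covers E n"
  shows "tight E (m + n) (\<lambda>i. a i + b i) i j \<longleftrightarrow> tight E m a i j \<and> tight E n b i j"
proof -
  have "m \<le> a i + a j" "n \<le> b i + b j" if "{i, j} \<in> E"
    using assms that by (simp_all add: coversD)
  then show ?thesis
    by (auto simp: tight_def)
qed

text \<open>
  A sum of covers is minimal iff its summands have a common tight edge at every vertex. All
  later arguments about products of generators come down to this.
\<close>

lemma tight_covers_add_iff:
  assumes "a \<in> covers E m" "b \<in> covers E n"
  shows "(\<lambda>i. a i + b i) \<in> tight_covers E (m + n) \<longleftrightarrow> (\<forall>i. \<exists>j. tight E m a i j \<and> tight E n b i j)"
proof -
  have "tight E (m + n) (\<lambda>i. a i + b i) i = (\<lambda>j. tight E m a i j \<and> tight E n b i j)" for i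
    by (rule ext) (rule tight_add_iff[OF assms])
  then show ?thesis
    by (simp add: tight_covers_def covers_add[OF assms])
qed

text \<open>
  The values 0 and \<open>n\<close> are sent to 0 and 2, and everything in between to 1. Every edge sum of the
  result is at least 2, and it exceeds 2 by at most the slack of that edge, so both parts are
  covers; since their sum is minimal, they are minimal and inherit all tight edges.
\<close>

lemma tight_covers_split:
  assumes "n \<ge> 2" "a \<in> tight_covers E n"
  obtains b c where "b \<in> tight_covers E 2" "c \<in> tight_covers E (n - 2)" "a = (\<lambda>i. b i + c i)"
    "\<And>i j. tight E n a i j \<Longrightarrow> tight E 2 b i j \<and> tight E (n - 2) c i j"
proof -
  define b where "b i = (if a i = 0 then 0 else if a i = n then 2 else (1::nat))" for i
  define c where "c i = a i - b i" for i
  have a: "a = (\<lambda>i. b i + c i)"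
    using assms(1) by (auto simp: b_def c_def)
  have le: "a i \<le> n" for i
    using assms(2) by (rule tight_cover_le)
  have sum: "2 \<le> b i + b j \<and> n - 2 \<le> c i + c j" if "{i, j} \<in> E" for i j
  proof -
    have "n \<le> a i + a j"
      using coversD[OF tight_covers_imp_covers[OF assms(2)] that] .
    then show ?thesis
      using le[of i] le[of j] assms(1) by (auto simp: b_def c_def)
  qed
  then have bc: "b \<in> covers E 2" "c \<in> covers E (n - 2)"
    by (auto simp: covers_def)
  have n: "2 + (n - 2) = n"
    using assms(1) by simp
  have both: "tight E n a i j \<longleftrightarrow> tight E 2 b i j \<and> tight E (n - 2) c i j" for i j
    using tight_add_iff[OF bc, of i j] by (simp only: n a[symmetric])
  then have "b \<in> tight_covers E 2" "c \<in> tight_covers E (n - 2)"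
    using bc assms(2) unfolding tight_covers_def by blast+
  from that[OF this a] both show thesis
    by blast
qed

abbreviation degree_of :: "('v::finite \<Rightarrow> nat) \<Rightarrow> nat" where
  "degree_of a \<equiv> \<Sum>i\<in>UNIV. a i"

definition max_degree :: "'v::finite set set \<Rightarrow> nat \<Rightarrow> nat" where
  "max_degree E n = Max (degree_of ` tight_covers E n)"

lemma degree_le_max_degree: "a \<in> tight_covers E n \<Longrightarrow> degree_of a \<le> max_degree E n"
  unfolding max_degree_def by (intro Max_ge) (auto intro: finite_tight_covers)

lemma max_degree_eqI:
  assumes "a \<in> tight_covers E n" "degree_of a = d"
    and "\<And>b. b \<in> tight_covers E n \<Longrightarrow> degree_of b \<le> d"
  shows "max_degree E n = d"
  unfolding max_degree_def using assms by (intro Max_eqI) (auto intro: finite_tight_covers)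

lemma max_degree_attained:
  assumes "tight_covers E n \<noteq> {}"
  obtains a where "a \<in> tight_covers E n" "degree_of a = max_degree E n"
proof -
  have "max_degree E n \<in> degree_of ` tight_covers E n"
    unfolding max_degree_def using assms by (intro Max_in) (auto intro: finite_tight_covers)
  then show thesis
    using that by auto
qed

lemma tight_covers_multiple:
  assumes "a \<in> tight_covers E n"
  shows "(\<lambda>i. s * a i) \<in> tight_covers E (s * n)"
proof -
  have "s * n \<le> s * a i + s * a j" if "{i, j} \<in> E" for i j
    using assms that by (simp add: tight_covers_def covers_def flip: distrib_left)
  moreover have "\<exists>j. {i, j} \<in> E \<and> s * a i + s * a j = s * n" for i
    using assms by (auto simp: tight_covers_def tight_def simp flip: distrib_left)
  ultimately show ?thesis
    by (simp add: tight_covers_def covers_def tight_def)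
qed

lemma all_ones_tight:
  assumes "simple_graph E" "no_isolated_vertex E"
  shows "tight E 2 (\<lambda>_. 1) i j \<longleftrightarrow> {i, j} \<in> E" "(\<lambda>_. 1) \<in> tight_covers E 2"
proof -
  show *: "tight E 2 (\<lambda>_. 1) i j \<longleftrightarrow> {i, j} \<in> E" for i j
    by (simp add: tight_def)
  have "\<exists>j. {i, j} \<in> E" for i
    using ex_neighbour[OF assms] by metis
  then have "\<forall>i. \<exists>j. tight E 2 (\<lambda>_. 1) i j"
    unfolding * by blast
  then show "(\<lambda>_. 1) \<in> tight_covers E 2"
    by (simp add: tight_covers_def covers_def)
qed

text \<open>
  Take 1 where \<open>a\<close> has value 2, take 0 where it has value 0, and a minimal vertex cover on the
  vertices of value 1. An edge with values 0 and 2 stays tight, and a vertex of value 1 has a tight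
  edge to another vertex of value 1, so minimality provides one that is tight for both.
\<close>

lemma compatible_cover_exists:
  fixes E :: "'v::finite set set"
  assumes E: "simple_graph E" and a: "a \<in> tight_covers E 2"
  obtains c where "c \<in> tight_covers E 1" "(\<lambda>i. a i + c i) \<in> tight_covers E 3"
proof -
  define c0 where "c0 i = (if a i = 0 then 0 else 1::nat)" for i
  \<comment> \<open>Minimizing the degree with the values off the level set of 1 prescribed gives the minimal
    vertex cover on that level set.\<close>
  define F where "F = {c \<in> covers E 1. \<forall>i. a i \<noteq> 1 \<longrightarrow> c i = c0 i}"
  have le2: "a i \<le> 2" for i
    using a by (rule tight_cover_le)
  have acov: "2 \<le> a i + a j" if "{i, j} \<in> E" for i j
    using coversD[OF tight_covers_imp_covers[OF a] that] .
  have "c0 \<in> F"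
    using acov by (fastforce simp: F_def covers_def c0_def)
  then obtain c where c: "c \<in> F" and cmin: "\<And>b. b \<in> F \<Longrightarrow> degree_of c \<le> degree_of b"
    using ex_has_least_nat[of "\<lambda>c. c \<in> F" c0 degree_of] by blast
  have ccov: "1 \<le> c i + c j" if "{i, j} \<in> E" for i j
    by (rule coversD[OF _ that]) (use c in \<open>simp add: F_def\<close>)
  have c_off: "c i = c0 i" if "a i \<noteq> 1" for i
    using c that by (auto simp: F_def)
  have reduce: "\<exists>j. {i, j} \<in> E \<and> a j = 1 \<and> c i + c j = 1" if i: "a i = 1" "c i > 0" for i
  proof (rule ccontr)
    assume no: "\<not> ?thesis"
    define b where "b = c(i := c i - 1)"
    have "1 \<le> b k + b l" if kl: "{k, l} \<in> E" for k l
    proof -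
      have *: "1 \<le> c i - 1 + c l" if il: "{i, l} \<in> E" for l
      proof (cases "a l = 1")
        case True
        with no il ccov[OF il] have "c i + c l \<ge> 2"
          by (metis (full_types) One_nat_def Suc_1 le_antisym not_less_eq_eq)
        then show ?thesis
          by simp
      next
        case False
        moreover have "a l \<ge> 1"
          using acov[OF il] i by simp
        ultimately show ?thesis
          using c_off[OF False] by (simp add: c0_def)
      qed
      have "k \<noteq> l"
        using E kl by (rule simple_graph_neq)
      then show ?thesis
        using ccov[OF kl] *[of l] *[of k] kl by (auto simp: b_def insert_commute add.commute)
    qed
    then have "b \<in> F"
      using c i by (auto simp: F_def covers_def b_def)
    moreover have "degree_of b < degree_of c"
      using i by (intro sum_strict_mono_ex1) (auto simp: b_def intro!: exI[of _ i])
    ultimately show False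
      using cmin[of b] by simp
  qed
  have "\<exists>j. tight E 2 a i j \<and> tight E 1 c i j" for i
  proof -
    obtain j where j: "{i, j} \<in> E" "a i + a j = 2"
      using a by (auto simp: tight_covers_def tight_def)
    show ?thesis
    proof (cases "a i = 1")
      case False
      with j have "c i + c j = 1"
        using c_off[of i] c_off[of j] le2[of i] by (auto simp: c0_def)
      with j show ?thesis
        by (auto simp: tight_def)
    next
      case True
      with j have aj: "a j = 1"
        by simp
      show ?thesis
      proof (cases "c i > 0")
        case True
        from reduce[OF \<open>a i = 1\<close> this] \<open>a i = 1\<close> show ?thesis
          by (auto simp: tight_def)
      next
        case False
        with ccov[OF j(1)] have "c j > 0"
          by simp
        from reduce[OF aj this] have "c j \<le> 1"
          by auto
        with False \<open>c j > 0\<close> j show ?thesis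
          by (auto simp: tight_def)
      qed
    qed
  qed
  moreover have "a \<in> covers E 2" "c \<in> covers E 1"
    using a c by (auto simp: tight_covers_def F_def)
  ultimately show thesis
    using that[of c] tight_covers_add_iff[of a E 2 c 1] by (auto simp: tight_covers_def)
qed

section \<open>Maximal degrees of minimal covers\<close>

text \<open>
  Splitting off minimal 2-covers bounds the degree by \<open>s\<close> times their maximal degree, and a
  multiple of one of maximal degree attains the bound.
\<close>

lemma max_degree_even:
  fixes E :: "'v::finite set set"
  assumes "tight_covers E 2 \<noteq> {}"
  shows "max_degree E (2 * s) = s * max_degree E 2"
proof -
  obtain a where a: "a \<in> tight_covers E 2" "degree_of a = max_degree E 2"
    using assms by (rule max_degree_attained)
  have "degree_of b \<le> s * max_degree E 2" if "b \<in> tight_covers E (2 * s)" for b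
    using that
  proof (induction s arbitrary: b)
    case 0
    then show ?case
      using tight_cover_le[of b E 0] by simp
  next
    case (Suc s)
    obtain b' c where "b' \<in> tight_covers E 2" "c \<in> tight_covers E (2 * Suc s - 2)"
        and b: "b = (\<lambda>i. b' i + c i)"
      by (rule tight_covers_split[OF _ Suc.prems]) simp_all
    moreover from this have "degree_of c \<le> s * max_degree E 2"
      by (intro Suc.IH) simp
    ultimately have "degree_of b' \<le> max_degree E 2" "degree_of c \<le> s * max_degree E 2"
      using degree_le_max_degree by auto
    then show ?case
      by (simp add: b sum.distrib)
  qed
  moreover have "(\<lambda>i. s * a i) \<in> tight_covers E (2 * s)"
    using tight_covers_multiple[OF a(1), of s] by (simp add: mult.commute)
  ultimately show ?thesis
    using a(2) by (intro max_degree_eqI) (auto simp flip: sum_distrib_left)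
qed

text \<open>
  The exponents of the generators whose maximal degree is the number \<open>e\<close> of the theorem. Adding any
  number of copies of \<open>b\<close> to \<open>c\<close> gives minimal covers, hence the name.
\<close>

definition stable_generators :: "'v::finite set set \<Rightarrow> ('v \<Rightarrow> nat) set" where
  "stable_generators E = {c \<in> tight_covers E 1. \<exists>b \<in> tight_covers E 2.
     degree_of b = max_degree E 2 \<and> (\<lambda>i. b i + c i) \<in> tight_covers E 3}"

text \<open>
  Adding further copies of the 2-cover \<open>b\<close> does not change which edges are tight for both
  summands.
\<close>

lemma odd_cover_lower:
  fixes E :: "'v::finite set set"
  assumes "c \<in> stable_generators E"
  obtains a where "a \<in> tight_covers E (2 * s + 1)" "degree_of a = s * max_degree E 2 + degree_of c"
proof -
  obtain b where b: "b \<in> tight_covers E 2" "degree_of b = max_degree E 2"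
      "(\<lambda>i. b i + c i) \<in> tight_covers E 3" and c: "c \<in> tight_covers E 1"
    using assms by (auto simp: stable_generators_def)
  have both: "\<forall>i. \<exists>j. tight E 2 b i j \<and> tight E 1 c i j"
    using tight_covers_add_iff[of b E 2 c 1] b c by (simp add: tight_covers_def)
  have sb: "(\<lambda>i. s * b i) \<in> covers E (s * 2)"
    using tight_covers_multiple[OF b(1), of s] by (simp add: tight_covers_def)
  have "tight E (s * 2) (\<lambda>i. s * b i) i j" if "tight E 2 b i j" for i j
    using that by (simp add: tight_def flip: distrib_left)
  with both have "\<forall>i. \<exists>j. tight E (s * 2) (\<lambda>i. s * b i) i j \<and> tight E 1 c i j"
    by blast
  then have "(\<lambda>i. s * b i + c i) \<in> tight_covers E (s * 2 + 1)"
    by (rule iffD2[OF tight_covers_add_iff[OF sb tight_covers_imp_covers[OF c]]])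
  then show thesis
    using b(2) by (intro that[of "\<lambda>i. s * b i + c i"])
      (simp_all add: sum.distrib mult.commute flip: sum_distrib_left)
qed

text \<open>
  A minimal \<open>(2 s + 1)\<close>-cover splits into \<open>s\<close> minimal 2-covers and one minimal 1-cover. Either all
  of the 2-covers have less than maximal degree, which costs \<open>s\<close> in total, or one of them has
  maximal degree. The tight edges are recorded so that in the latter case this 2-cover and the
  1-cover can be seen to have a minimal sum.
\<close>

lemma odd_cover_decompose:
  fixes E :: "'v::finite set set"
  assumes "a \<in> tight_covers E (2 * s + 1)"
  shows "\<exists>c \<in> tight_covers E 1. (\<forall>i j. tight E (2 * s + 1) a i j \<longrightarrow> tight E 1 c i j) \<and>
    (degree_of a + s \<le> s * max_degree E 2 + degree_of c \<or>
     degree_of a \<le> s * max_degree E 2 + degree_of c \<and>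
     (\<exists>b \<in> tight_covers E 2. degree_of b = max_degree E 2 \<and>
        (\<forall>i j. tight E (2 * s + 1) a i j \<longrightarrow> tight E 2 b i j)))"
  using assms
proof (induction s arbitrary: a)
  case 0
  then show ?case by auto
next
  case (Suc s)
  let ?D = "max_degree E 2"
  obtain b a' where b: "b \<in> tight_covers E 2" and a': "a' \<in> tight_covers E (2 * s + 1)"
      and a: "a = (\<lambda>i. b i + a' i)"
      and t: "\<And>i j. tight E (2 * Suc s + 1) a i j \<Longrightarrow> tight E 2 b i j \<and> tight E (2 * s + 1) a' i j"
    using tight_covers_split[of "2 * Suc s + 1" a E] Suc.prems by auto
  obtain c where c: "c \<in> tight_covers E 1"
      "\<And>i j. tight E (2 * s + 1) a' i j \<Longrightarrow> tight E 1 c i j"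
      "degree_of a' + s \<le> s * ?D + degree_of c \<or>
       degree_of a' \<le> s * ?D + degree_of c \<and>
       (\<exists>b \<in> tight_covers E 2. degree_of b = ?D \<and>
          (\<forall>i j. tight E (2 * s + 1) a' i j \<longrightarrow> tight E 2 b i j))"
    using Suc.IH[OF a'] by blast
  have deg: "degree_of a = degree_of b + degree_of a'"
    by (simp add: a sum.distrib)
  have le: "degree_of b \<le> ?D"
    using b by (rule degree_le_max_degree)
  have "degree_of a + Suc s \<le> Suc s * ?D + degree_of c \<or>
     degree_of a \<le> Suc s * ?D + degree_of c \<and>
     (\<exists>b \<in> tight_covers E 2. degree_of b = ?D \<and>
        (\<forall>i j. tight E (2 * Suc s + 1) a i j \<longrightarrow> tight E 2 b i j))"
  proof (cases "degree_of b = ?D")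
    case True
    then have "degree_of a \<le> Suc s * ?D + degree_of c"
      using c(3) deg by auto
    with True b t show ?thesis
      by blast
  next
    case False
    with le have "degree_of b + 1 \<le> ?D"
      by simp
    with c(3) deg t show ?thesis
      by auto
  qed
  with c t show ?case
    by blast
qed

text \<open>
  In the first case of the decomposition the loss \<open>s\<close> makes up for the difference between the maximal
  degree of all minimal 1-covers and \<open>e\<close>; this is where the lower bound on \<open>s\<close> comes from. In the
  second case the 1-cover is one of those counted by \<open>e\<close>.
\<close>

lemma max_degree_odd:
  fixes E :: "'v::finite set set"
  assumes "stable_generators E \<noteq> {}"
    and e: "e = Max (degree_of ` stable_generators E)"
    and s: "max_degree E 1 \<le> e + s"
  shows "max_degree E (2 * s + 1) = s * max_degree E 2 + e"
proof -
  have fin: "finite (stable_generators E)"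
    using finite_tight_covers[of E 1] by (rule finite_subset[rotated]) (auto simp: stable_generators_def)
  then have "e \<in> degree_of ` stable_generators E"
    unfolding e using assms(1) by (intro Max_in) auto
  then obtain c0 where "c0 \<in> stable_generators E" "degree_of c0 = e"
    by auto
  then obtain a where a: "a \<in> tight_covers E (2 * s + 1)" "degree_of a = s * max_degree E 2 + e"
    using odd_cover_lower by metis
  show ?thesis
  proof (rule max_degree_eqI[OF a])
    fix x
    assume x: "x \<in> tight_covers E (2 * s + 1)"
    obtain c where c: "c \<in> tight_covers E 1"
      "\<And>i j. tight E (2 * s + 1) x i j \<Longrightarrow> tight E 1 c i j"
      "degree_of x + s \<le> s * max_degree E 2 + degree_of c \<or>
       degree_of x \<le> s * max_degree E 2 + degree_of c \<and>
       (\<exists>b \<in> tight_covers E 2. degree_of b = max_degree E 2 \<and>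
          (\<forall>i j. tight E (2 * s + 1) x i j \<longrightarrow> tight E 2 b i j))"
      using odd_cover_decompose[OF x] by blast
    from c(3) show "degree_of x \<le> s * max_degree E 2 + e"
    proof (elim disjE conjE bexE)
      assume "degree_of x + s \<le> s * max_degree E 2 + degree_of c"
      with s degree_le_max_degree[OF c(1)] show ?thesis
        by simp
    next
      fix b
      assume x_le: "degree_of x \<le> s * max_degree E 2 + degree_of c"
        and b: "b \<in> tight_covers E 2" "degree_of b = max_degree E 2"
          "\<forall>i j. tight E (2 * s + 1) x i j \<longrightarrow> tight E 2 b i j"
      have "\<forall>i. \<exists>j. tight E 2 b i j \<and> tight E 1 c i j"
        using x b(3) c(2) unfolding tight_covers_def by blast
      then have "(\<lambda>i. b i + c i) \<in> tight_covers E 3"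
        using tight_covers_add_iff[of b E 2 c 1] b(1) c(1) by (simp add: tight_covers_def)
      with b c(1) have "c \<in> stable_generators E"
        by (auto simp: stable_generators_def)
      then have "degree_of c \<le> e"
        unfolding e using fin by (intro Max_ge) auto
      with x_le show ?thesis
        by simp
    qed
  qed
qed

no_notation fps_nth (infixl \<open>$\<close> 75)

section \<open>Vertices of the symbolic polyhedron\<close>

text \<open>
  A direction that keeps all active constraints active can be followed a little way both forwards
  and backwards, which is impossible at an extreme point unless the direction is 0.
\<close>

lemma extreme_point_no_perturbation:
  fixes x d :: "real ^ 'v::finite"
  assumes x: "x extreme_point_of symbolic_polyhedron E"
    and le1: "\<And>i. \<bar>d $ i\<bar> \<le> 1" and zero: "\<And>i. x $ i = 0 \<Longrightarrow> d $ i = 0"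
    and edge: "\<And>i j. {i, j} \<in> E \<Longrightarrow> x $ i + x $ j = 1 \<Longrightarrow> d $ i + d $ j = 0"
  shows "d = 0"
proof (rule ccontr)
  assume "d \<noteq> 0"
  \<comment> \<open>The positive slacks of the constraints at \<open>x\<close>; the 1 only makes the set nonempty.\<close>
  define S where "S = {t \<in> insert 1 (range (\<lambda>i. x $ i) \<union> range (\<lambda>(i, j). x $ i + x $ j - 1)). 0 < t}"
  define \<epsilon> where "\<epsilon> = Min S / 2"
  have S: "finite S" "S \<noteq> {}"
    by (auto simp: S_def)
  then have "Min S \<in> S"
    by (rule Min_in)
  then have \<epsilon>: "\<epsilon> > 0"
    by (simp add: S_def \<epsilon>_def)
  have S_ge: "2 * \<epsilon> \<le> t" if "t \<in> S" for t
    using S that by (simp add: \<epsilon>_def)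
  have xP: "x \<in> symbolic_polyhedron E"
    using x by (simp add: extreme_point_of_def)
  have inP: "x + r *\<^sub>R d \<in> symbolic_polyhedron E" if r: "\<bar>r\<bar> \<le> \<epsilon>" for r
  proof -
    have rd: "\<bar>r * d $ i\<bar> \<le> \<epsilon>" for i
      using mult_mono[OF r le1[of i]] \<epsilon> by (simp add: abs_mult)
    have "0 \<le> x $ i + r * d $ i" for i
    proof (cases "x $ i = 0")
      case False
      then have "x $ i > 0"
        using xP by (simp add: symbolic_polyhedron_def order_less_le)
      then have "2 * \<epsilon> \<le> x $ i"
        by (intro S_ge) (auto simp: S_def)
      then show ?thesis
        using rd[of i] \<epsilon> by linarith
    qed (simp add: zero)
    moreover have "1 \<le> (x $ i + r * d $ i) + (x $ j + r * d $ j)" if ij: "{i, j} \<in> E" for i j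
    proof (cases "x $ i + x $ j = 1")
      case True
      then have "r * d $ i + r * d $ j = 0"
        using edge[OF ij] by (simp flip: distrib_left)
      with True show ?thesis
        by linarith
    next
      case False
      moreover have "x $ i + x $ j \<ge> 1"
        using xP ij by (simp add: symbolic_polyhedron_def)
      ultimately have "x $ i + x $ j - 1 > 0"
        by simp
      then have "2 * \<epsilon> \<le> x $ i + x $ j - 1"
        by (intro S_ge) (auto simp: S_def)
      then show ?thesis
        using rd[of i] rd[of j] by linarith
    qed
    ultimately show ?thesis
      by (simp add: symbolic_polyhedron_def)
  qed
  let ?a = "x + (- \<epsilon>) *\<^sub>R d" and ?b = "x + \<epsilon> *\<^sub>R d"
  have "?a \<in> symbolic_polyhedron E" "?b \<in> symbolic_polyhedron E"
    using \<epsilon> by (simp_all only: inP abs_minus_cancel abs_of_pos order_refl)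
  moreover have "x \<in> open_segment ?a ?b"
  proof -
    have "?b - ?a = (\<epsilon> + \<epsilon>) *\<^sub>R d"
      by (simp only: scaleR_left_distrib) simp
    then have "?b - ?a \<noteq> 0"
      using \<epsilon> \<open>d \<noteq> 0\<close> by (metis add_pos_pos less_irrefl scaleR_eq_0_iff)
    then have "?a \<noteq> ?b"
      by auto
    moreover have "x = midpoint ?a ?b"
      by (simp add: midpoint_def flip: scaleR_left_distrib)
    ultimately show ?thesis
      by (metis midpoint_in_open_segment)
  qed
  ultimately show False
    using x by (simp add: extreme_point_of_def)
qed

text \<open>
  A positive coordinate without a tight edge could be moved alone in both directions. For a zero
  coordinate the argument is the one for minimal covers.
\<close>

lemma extreme_point_tight:
  fixes x :: "real ^ 'v::finite"
  assumes E: "simple_graph E" "no_isolated_vertex E"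
    and x: "x extreme_point_of symbolic_polyhedron E"
  obtains j where "{i, j} \<in> E" "x $ i + x $ j = 1"
proof -
  have "x \<in> symbolic_polyhedron E"
    using x by (simp add: extreme_point_of_def)
  then have xP: "x $ i \<ge> 0" "{i, j} \<in> E \<Longrightarrow> x $ i + x $ j \<ge> 1" for i j
    by (simp_all add: symbolic_polyhedron_def)
  have pos: "\<exists>j. {i, j} \<in> E \<and> x $ i + x $ j = 1" if i: "x $ i > 0" for i
  proof (rule ccontr)
    assume no: "\<not> ?thesis"
    have "axis i (1::real) = 0"
    proof (rule extreme_point_no_perturbation[OF x])
      fix k l
      assume kl: "{k, l} \<in> E" "x $ k + x $ l = 1"
      then have "k \<noteq> i" "l \<noteq> i"
        using no by (auto simp: insert_commute add.commute)
      then show "axis i 1 $ k + axis i 1 $ l = (0::real)"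
        by (simp add: axis_def)
    qed (use i in \<open>auto simp: axis_def\<close>)
    then show False
      by (simp add: axis_eq_0_iff)
  qed
  show thesis
  proof (cases "x $ i > 0")
    case True
    then show thesis
      using pos that by blast
  next
    case False
    then have i: "x $ i = 0"
      using xP(1)[of i] by simp
    obtain j where j: "{i, j} \<in> E"
      using E by (rule ex_neighbour)
    then have "x $ j \<ge> 1"
      using xP(2)[OF j] i by simp
    then obtain k where "x $ j + x $ k = 1"
      using pos[of j] by auto
    with xP(1)[of k] \<open>x $ j \<ge> 1\<close> have "x $ j = 1"
      by simp
    with i j that show thesis
      by simp
  qed
qed

text \<open>
  Increasing the coordinates strictly between 0 and \<open>1/2\<close> and decreasing those strictly between
  \<open>1/2\<close> and 1 at the same rate preserves all tight edges, so an extreme point has no such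
  coordinates.
\<close>

lemma extreme_point_half_integral:
  fixes x :: "real ^ 'v::finite"
  assumes E: "simple_graph E" "no_isolated_vertex E"
    and x: "x extreme_point_of symbolic_polyhedron E"
  shows "x $ i \<in> {0, 1/2, 1}"
proof -
  have nonneg: "0 \<le> x $ i" for i
    using x by (simp add: extreme_point_of_def symbolic_polyhedron_def)
  have le1: "x $ i \<le> 1" for i
    using extreme_point_tight[OF E x, of i] nonneg by (metis add.commute le_add_same_cancel2)
  define d :: "real ^ 'v" where "d = (\<chi> k. if 0 < x $ k \<and> x $ k < 1/2 then 1
    else if 1/2 < x $ k \<and> x $ k < 1 then -1 else 0)"
  have "d = 0"
  proof (rule extreme_point_no_perturbation[OF x])
    fix k l
    assume "x $ k + x $ l = 1"
    then have l: "x $ l = 1 - x $ k"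
      by simp
    show "d $ k + d $ l = 0"
      by (simp add: d_def l)
  qed (auto simp: d_def)
  then have "d $ i = 0"
    by simp
  then show ?thesis
    using nonneg[of i] le1[of i] by (auto simp: d_def split: if_splits)
qed

lemma extreme_point_tight_cover:
  fixes x :: "real ^ 'v::finite"
  assumes E: "simple_graph E" "no_isolated_vertex E"
    and x: "x extreme_point_of symbolic_polyhedron E"
  obtains a where "a \<in> tight_covers E 2" "x = (\<chi> i. real (a i) / 2)"
proof -
  define a where "a i = nat \<lfloor>2 * x $ i\<rfloor>" for i
  have a: "real (a i) = 2 * x $ i" for i
  proof -
    have "2 * x $ i = 0 \<or> 2 * x $ i = 1 \<or> 2 * x $ i = 2"
      using extreme_point_half_integral[OF E x, of i] by auto
    then show ?thesis
      by (elim disjE) (simp_all only: a_def, simp_all)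
  qed
  have "2 \<le> a i + a j" if "{i, j} \<in> E" for i j
  proof -
    have "x $ i + x $ j \<ge> 1"
      using x that by (simp add: extreme_point_of_def symbolic_polyhedron_def)
    then have "real 2 \<le> real (a i + a j)"
      by (simp add: a)
    then show ?thesis
      by (simp only: of_nat_le_iff)
  qed
  moreover have "\<exists>j. tight E 2 a i j" for i
  proof -
    obtain j where j: "{i, j} \<in> E" "x $ i + x $ j = 1"
      using E x by (rule extreme_point_tight)
    then have "real (a i + a j) = real 2"
      by (simp add: a)
    with j show ?thesis
      unfolding tight_def of_nat_eq_iff by blast
  qed
  ultimately have "a \<in> tight_covers E 2"
    by (simp add: tight_covers_def covers_def)
  moreover have "x = (\<chi> i. real (a i) / 2)"
    by (simp add: vec_eq_iff a)
  ultimately show thesis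
    by (rule that)
qed

lemma finite_extreme_points:
  fixes E :: "'v::finite set set"
  assumes "simple_graph E" "no_isolated_vertex E"
  shows "finite {x. x extreme_point_of symbolic_polyhedron E}"
proof (rule finite_subset)
  show "{x. x extreme_point_of symbolic_polyhedron E} \<subseteq>
      (\<lambda>a. \<chi> i. real (a i) / 2) ` tight_covers E 2"
    using extreme_point_tight_cover[OF assms] by blast
qed (simp add: finite_tight_covers)

lemma convex_symbolic_polyhedron: "convex (symbolic_polyhedron E :: (real ^ 'v::finite) set)"
proof (rule convexI)
  fix x y :: "real ^ 'v" and u v :: real
  assume xy: "x \<in> symbolic_polyhedron E" "y \<in> symbolic_polyhedron E"
    and uv: "0 \<le> u" "0 \<le> v" "u + v = 1"
  have "1 \<le> (u * x $ i + v * y $ i) + (u * x $ j + v * y $ j)" if "{i, j} \<in> E" for i j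
  proof -
    have "1 \<le> x $ i + x $ j" "1 \<le> y $ i + y $ j"
      using xy that by (auto simp: symbolic_polyhedron_def)
    then have "u * 1 + v * 1 \<le> u * (x $ i + x $ j) + v * (y $ i + y $ j)"
      using uv by (intro add_mono mult_left_mono)
    then show ?thesis
      using uv by (simp add: algebra_simps)
  qed
  then show "u *\<^sub>R x + v *\<^sub>R y \<in> symbolic_polyhedron E"
    using xy uv by (simp add: symbolic_polyhedron_def)
qed

text \<open>
  The point \<open>b/2\<close> lies on the face cut out by the tight edges of \<open>b\<close>. As every vertex is on a tight
  edge, all coordinates on this face are at most 1, so the face is compact and hence the convex hull
  of its extreme points, which are extreme points of the whole unbounded polyhedron.
\<close>

lemma degree_le_of_extreme_point_bound:
  fixes E :: "'v::finite set set"
  assumes b: "b \<in> tight_covers E 2"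
    and bound: "\<And>x. x extreme_point_of symbolic_polyhedron E \<Longrightarrow> (\<Sum>i\<in>UNIV. x $ i) \<le> D"
  shows "real (degree_of b) \<le> 2 * D"
proof -
  define F where "F = {x \<in> symbolic_polyhedron E. \<forall>i j. tight E 2 b i j \<longrightarrow> x $ i + x $ j = 1}"
  have F_eq: "F = symbolic_polyhedron E \<inter> {x. \<forall>i j. tight E 2 b i j \<longrightarrow> x $ i + x $ j = 1}"
    by (auto simp: F_def)
  have "convex F"
    unfolding F_eq
  proof (intro convex_Int convex_symbolic_polyhedron convexI)
    fix x y :: "real ^ 'v" and u v :: real
    assume xy: "x \<in> {x. \<forall>i j. tight E 2 b i j \<longrightarrow> x $ i + x $ j = 1}"
        "y \<in> {x. \<forall>i j. tight E 2 b i j \<longrightarrow> x $ i + x $ j = 1}" and uv: "u + v = 1"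
    have "(u * x $ i + v * y $ i) + (u * x $ j + v * y $ j) = 1" if "tight E 2 b i j" for i j
    proof -
      have "x $ i + x $ j = 1" "y $ i + y $ j = 1"
        using xy that by auto
      moreover have "(u * x $ i + v * y $ i) + (u * x $ j + v * y $ j) =
          u * (x $ i + x $ j) + v * (y $ i + y $ j)"
        by (simp add: algebra_simps)
      ultimately show ?thesis
        using uv by simp
    qed
    then show "u *\<^sub>R x + v *\<^sub>R y \<in> {x. \<forall>i j. tight E 2 b i j \<longrightarrow> x $ i + x $ j = 1}"
      by simp
  qed
  have face: "F face_of symbolic_polyhedron E"
    unfolding face_of_def
  proof (intro conjI ballI impI)
    fix x y z
    assume x: "x \<in> symbolic_polyhedron E" and y: "y \<in> symbolic_polyhedron E" and z: "z \<in> F"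
      and "z \<in> open_segment x y"
    then obtain u where u: "0 < u" "u < 1" "z = (1 - u) *\<^sub>R x + u *\<^sub>R y"
      by (auto simp: in_segment)
    have "x $ i + x $ j = 1 \<and> y $ i + y $ j = 1" if t: "tight E 2 b i j" for i j
    proof -
      let ?p = "x $ i + x $ j - 1" and ?q = "y $ i + y $ j - 1"
      have "{i, j} \<in> E"
        using t by (simp add: tight_def)
      then have "0 \<le> ?p" "0 \<le> ?q"
        using x y by (auto simp: symbolic_polyhedron_def)
      then have nonneg: "0 \<le> (1 - u) * ?p" "0 \<le> u * ?q"
        using u by simp_all
      have "z $ i + z $ j = 1"
        using z t by (simp add: F_def)
      then have "(1 - u) * ?p + u * ?q = 0"
        by (simp add: u(3) algebra_simps)
      with nonneg have "(1 - u) * ?p = 0" "u * ?q = 0"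
        by linarith+
      then show ?thesis
        using u by simp
    qed
    with x y show "x \<in> F" "y \<in> F"
      by (auto simp: F_def)
  qed (use \<open>convex F\<close> in \<open>auto simp: F_def\<close>)
  have "closed F"
    unfolding F_def symbolic_polyhedron_def mem_Collect_eq
    by (intro closed_Collect_conj closed_Collect_all closed_Collect_imp closed_Collect_le
        closed_Collect_eq open_Collect_const continuous_intros)
  moreover have "F \<subseteq> cbox 0 1"
  proof
    fix x assume x: "x \<in> F"
    have nonneg: "0 \<le> x $ i" for i
      using x by (simp add: F_def symbolic_polyhedron_def)
    have "x $ i \<le> 1" for i
    proof -
      obtain j where "tight E 2 b i j"
        using b by (auto simp: tight_covers_def)
      with x have "x $ i + x $ j = 1"
        by (simp add: F_def)
      with nonneg[of j] show ?thesis
        by linarith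
    qed
    with nonneg show "x \<in> cbox 0 1"
      by (simp add: mem_box_cart)
  qed
  then have "bounded F"
    using bounded_cbox bounded_subset by blast
  ultimately have "compact F"
    by (simp add: compact_eq_bounded_closed)
  have sum_inner: "(1 :: real ^ 'v) \<bullet> x = (\<Sum>i\<in>UNIV. x $ i)" for x
    by (simp add: inner_vec_def)
  have "{x. x extreme_point_of F} \<subseteq> {x. 1 \<bullet> x \<le> D}"
    using extreme_point_of_face[OF face] bound by (auto simp: sum_inner)
  then have "convex hull {x. x extreme_point_of F} \<subseteq> {x. 1 \<bullet> x \<le> D}"
    by (intro hull_minimal convex_halfspace_le)
  then have "F \<subseteq> {x. 1 \<bullet> x \<le> D}"
    using Krein_Milman_Minkowski[OF \<open>compact F\<close> \<open>convex F\<close>] by simp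
  moreover have "(\<chi> i. real (b i) / 2) \<in> F"
  proof -
    have "1 \<le> real (b i) / 2 + real (b j) / 2" if "{i, j} \<in> E" for i j
    proof -
      have "2 \<le> b i + b j"
        by (rule coversD[OF tight_covers_imp_covers[OF b] that])
      then show ?thesis
        by simp
    qed
    moreover have "real (b i) / 2 + real (b j) / 2 = 1" if "tight E 2 b i j" for i j
    proof -
      have "b i + b j = 2"
        using that by (simp add: tight_def)
      then have "real (b i) + real (b j) = 2"
        by (metis of_nat_add of_nat_numeral)
      then show ?thesis
        by simp
    qed
    ultimately show ?thesis
      by (simp add: F_def symbolic_polyhedron_def)
  qed
  ultimately have "(\<Sum>i\<in>UNIV. real (b i) / 2) \<le> D"
    by (auto simp: sum_inner)
  then show ?thesis
    by (simp flip: sum_divide_distrib)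
qed

text \<open>
  Doubling an extreme point gives a minimal 2-cover. Conversely a minimal 2-cover need not be twice
  an extreme point, but its degree is bounded by the maximum over the extreme points.
\<close>

lemma delta_eq:
  fixes E :: "'v::finite set set"
  assumes E: "simple_graph E" "no_isolated_vertex E"
  shows "real (max_degree E 2) = 2 * delta E"
proof (rule antisym)
  let ?V = "{x. x extreme_point_of symbolic_polyhedron E}"
  let ?size = "\<lambda>x :: real ^ 'v. \<Sum>i\<in>UNIV. x $ i"
  have fin: "finite (?size ` ?V)"
    using finite_extreme_points[OF E] by simp
  have ne: "tight_covers E 2 \<noteq> {}"
    using all_ones_tight(2)[OF E] by blast
  obtain b where b: "b \<in> tight_covers E 2" "degree_of b = max_degree E 2"
    using ne by (rule max_degree_attained)
  have "real (degree_of b) \<le> 2 * delta E"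
    using b(1)
  proof (rule degree_le_of_extreme_point_bound)
    fix x assume "x extreme_point_of symbolic_polyhedron E"
    then show "?size x \<le> delta E"
      unfolding delta_def using fin by (intro Max_ge) auto
  qed
  then show "real (max_degree E 2) \<le> 2 * delta E"
    by (simp only: b(2))
  have "?V \<noteq> {}"
  proof
    assume "?V = {}"
    \<comment> \<open>Without extreme points any number would bound their coordinate sums, even a negative one.\<close>
    then have "real (degree_of b) \<le> 2 * (-1)"
      by (intro degree_le_of_extreme_point_bound[OF b(1)]) auto
    then show False
      using of_nat_0_le_iff[of "degree_of b"] by linarith
  qed
  then have "delta E \<in> ?size ` ?V"
    unfolding delta_def using fin by (intro Max_in) auto
  then obtain x where x: "x extreme_point_of symbolic_polyhedron E" "delta E = ?size x"
    by auto
  obtain a where a: "a \<in> tight_covers E 2" "x = (\<chi> i. real (a i) / 2)"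
    using E x(1) by (rule extreme_point_tight_cover)
  have "2 * delta E = real (degree_of a)"
    by (simp add: x(2) a(2) flip: sum_divide_distrib)
  also have "\<dots> \<le> real (max_degree E 2)"
    using degree_le_max_degree[OF a(1)] by (simp only: of_nat_le_iff)
  finally show "2 * delta E \<le> real (max_degree E 2)" .
qed

section \<open>Generators of the symbolic powers\<close>

definition exp_monomial :: "('v \<Rightarrow> nat) \<Rightarrow> ('v::finite, 'k::field) mpoly" where
  "exp_monomial a = monomial (Abs_poly_mapping a)"

lemma exp_monomial_eq_iff: "exp_monomial a = exp_monomial b \<longleftrightarrow> a = b"
proof -
  have "Abs_poly_mapping a = Abs_poly_mapping b \<longleftrightarrow> a = b"
    by (metis finite lookup_Abs_poly_mapping)
  then show ?thesis
    by (simp add: exp_monomial_def)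
qed

lemma exp_monomial_mult: "exp_monomial a * exp_monomial b = exp_monomial (\<lambda>i. a i + b i)"
proof -
  have "Abs_poly_mapping a + Abs_poly_mapping b = Abs_poly_mapping (\<lambda>i. a i + b i)"
    by (intro poly_mapping_eqI) (simp add: lookup_add)
  then show ?thesis
    by (simp add: exp_monomial_def monomial_mult)
qed

lemma total_degree_exp_monomial: "total_degree (exp_monomial a) = degree_of a"
  by (simp add: total_degree_def exp_monomial_def)

lemma exp_monomial_in_image_iff: "exp_monomial a \<in> exp_monomial ` S \<longleftrightarrow> a \<in> S"
  by (auto simp: exp_monomial_eq_iff)

lemma cover_exps_eq_covers:
  fixes E :: "'v::finite set set"
  assumes "simple_graph E"
  shows "{a. \<forall>e\<in>E. n \<le> weight e a} = {a. Poly_Mapping.lookup a \<in> covers E n}"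
proof -
  have w: "weight {i, j} a = Poly_Mapping.lookup a i + Poly_Mapping.lookup a j"
    if "{i, j} \<in> E" for i j and a :: "'v \<Rightarrow>\<^sub>0 nat"
    using simple_graph_neq[OF assms that] by (simp add: weight_def)
  have "(\<forall>e\<in>E. n \<le> weight e a) \<longleftrightarrow> Poly_Mapping.lookup a \<in> covers E n" for a
  proof
    assume "\<forall>e\<in>E. n \<le> weight e a"
    then show "Poly_Mapping.lookup a \<in> covers E n"
      unfolding covers_def using w by fastforce
  next
    assume a: "Poly_Mapping.lookup a \<in> covers E n"
    show "\<forall>e\<in>E. n \<le> weight e a"
    proof
      fix e assume e: "e \<in> E"
      then obtain i j where "e = {i, j}"
        using simple_graph_edgeE[OF assms] by blast
      with e show "n \<le> weight e a"
        using coversD[OF a] w by simp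
    qed
  qed
  then show ?thesis
    by blast
qed

lemma minimal_exps_covers:
  fixes E :: "'v::finite set set"
  assumes E: "simple_graph E" "no_isolated_vertex E"
  shows "minimal_exps {a. Poly_Mapping.lookup a \<in> covers E n} =
    {a. Poly_Mapping.lookup a \<in> tight_covers E n}"
proof (intro Set.set_eqI iffI)
  fix a :: "'v \<Rightarrow>\<^sub>0 nat"
  assume a: "a \<in> minimal_exps {a. Poly_Mapping.lookup a \<in> covers E n}"
  have "b = Poly_Mapping.lookup a"
    if b: "b \<in> covers E n" "\<And>i. b i \<le> Poly_Mapping.lookup a i" for b
  proof -
    have "Abs_poly_mapping b = a"
      using a b by (simp add: minimal_exps_def divides_exp_def)
    then show ?thesis
      by (metis finite lookup_Abs_poly_mapping)
  qed
  with a have "Poly_Mapping.lookup a \<in> tight_covers E n"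
    by (intro minimal_cover_imp_tight[OF E]) (auto simp: minimal_exps_def)
  then show "a \<in> {a. Poly_Mapping.lookup a \<in> tight_covers E n}"
    by simp
next
  fix a :: "'v \<Rightarrow>\<^sub>0 nat"
  assume "a \<in> {a. Poly_Mapping.lookup a \<in> tight_covers E n}"
  then have a: "Poly_Mapping.lookup a \<in> tight_covers E n"
    by simp
  have "b = a" if "Poly_Mapping.lookup b \<in> covers E n" "divides_exp b a" for b
    using tight_cover_le_imp_eq[OF a that(1)] that(2)
    by (simp add: divides_exp_def poly_mapping_eqI)
  with a show "a \<in> minimal_exps {a. Poly_Mapping.lookup a \<in> covers E n}"
    by (simp add: minimal_exps_def tight_covers_imp_covers)
qed

lemma min_gens_cover_span:
  fixes E :: "'v::finite set set"
  assumes E: "simple_graph E" "no_isolated_vertex E"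
  shows "min_gens (monomial_span {a. \<forall>e\<in>E. n \<le> weight e a} :: ('v, 'k::field) mpoly set) =
    exp_monomial ` tight_covers E n"
proof -
  have "{a. Poly_Mapping.lookup a \<in> tight_covers E n} = Abs_poly_mapping ` tight_covers E n"
  proof (intro Set.set_eqI iffI)
    fix a :: "'v \<Rightarrow>\<^sub>0 nat"
    assume "a \<in> {a. Poly_Mapping.lookup a \<in> tight_covers E n}"
    then have "Abs_poly_mapping (Poly_Mapping.lookup a) \<in> Abs_poly_mapping ` tight_covers E n"
      by (intro imageI) simp
    then show "a \<in> Abs_poly_mapping ` tight_covers E n"
      by (simp only: Poly_Mapping.lookup_inverse)
  qed auto
  then have "minimal_exps {a. \<forall>e\<in>E. n \<le> weight e a} = Abs_poly_mapping ` tight_covers E n"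
    by (simp only: cover_exps_eq_covers[OF E(1)] minimal_exps_covers[OF E])
  then show ?thesis
    by (simp add: min_gens_monomial_span[OF up_closure_cover_exps] image_image exp_monomial_def)
qed

lemma min_gens_symbolic_power:
  fixes E :: "'v::finite set set"
  assumes E: "simple_graph E" "no_isolated_vertex E"
  shows "min_gens (symbolic_power mpoly_ring (cover_ideal E :: ('v, 'k::field) mpoly set) n) =
    exp_monomial ` tight_covers E n"
proof -
  have "e = f" if "e \<in> E" "f \<in> E" "e \<subseteq> f" for e f
    using that E(1) by (intro card_subset_eq) (auto simp: simple_graph_def)
  then show ?thesis
    by (simp only: symbolic_power_cover_ideal min_gens_cover_span[OF E])
qed

lemma min_gens_cover_ideal:
  fixes E :: "'v::finite set set"
  assumes E: "simple_graph E" "no_isolated_vertex E"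
  shows "min_gens (cover_ideal E :: ('v, 'k::field) mpoly set) = exp_monomial ` tight_covers E 1"
  by (simp only: cover_ideal_eq_Inter Inter_order_ideal min_gens_cover_span[OF E])

lemma omega_eq_max_degree:
  fixes E :: "'v::finite set set"
  assumes E: "simple_graph E" "no_isolated_vertex E"
  shows "omega (symbolic_power mpoly_ring (cover_ideal E :: ('v, 'k::field) mpoly set) n) = max_degree E n"
    "omega (cover_ideal E :: ('v, 'k::field) mpoly set) = max_degree E 1"
  by (simp_all only: omega_def min_gens_symbolic_power[OF E] min_gens_cover_ideal[OF E]
      image_image total_degree_exp_monomial max_degree_def)

section \<open>The degrees of the symbolic powers\<close>

lemma stable_generators_nonempty:
  fixes E :: "'v::finite set set"
  assumes E: "simple_graph E" "no_isolated_vertex E"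
  shows "stable_generators E \<noteq> {}"
proof -
  have "tight_covers E 2 \<noteq> {}"
    using all_ones_tight(2)[OF E] by blast
  then obtain b where b: "b \<in> tight_covers E 2" "degree_of b = max_degree E 2"
    by (rule max_degree_attained)
  obtain c where "c \<in> tight_covers E 1" "(\<lambda>i. b i + c i) \<in> tight_covers E 3"
    using E(1) b(1) by (rule compatible_cover_exists)
  with b have "c \<in> stable_generators E"
    by (auto simp: stable_generators_def)
  then show ?thesis
    by blast
qed

lemma stable_generators_image:
  fixes E :: "'v::finite set set"
  assumes E: "simple_graph E" "no_isolated_vertex E"
  shows "{m2 \<in> min_gens (cover_ideal E :: ('v, 'k::field) mpoly set).
      \<exists>m1 \<in> min_gens (symbolic_power mpoly_ring (cover_ideal E) 2).
        real (total_degree m1) = 2 * delta E \<and>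
        m1 * m2 \<in> min_gens (symbolic_power mpoly_ring (cover_ideal E) 3)} =
    exp_monomial ` stable_generators E"
  unfolding min_gens_symbolic_power[OF E] min_gens_cover_ideal[OF E] delta_eq[OF E, symmetric]
  by (auto simp: stable_generators_def total_degree_exp_monomial exp_monomial_mult
      exp_monomial_in_image_iff exp_monomial_eq_iff)

lemma max_stable_degree_eq:
  fixes E :: "'v::finite set set"
  assumes "c \<in> stable_generators E" "degree_of c = max_degree E 1"
  shows "Max (degree_of ` stable_generators E) = max_degree E 1"
proof (rule Max_eqI)
  show "finite (degree_of ` stable_generators E)"
    by (rule finite_imageI, rule finite_subset[OF _ finite_tight_covers[of E 1]])
      (auto simp: stable_generators_def)
  show "max_degree E 1 \<in> degree_of ` stable_generators E"
    using assms by (intro image_eqI[where x = c]) simp_all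
  fix d assume "d \<in> degree_of ` stable_generators E"
  then show "d \<le> max_degree E 1"
    using degree_le_max_degree by (auto simp: stable_generators_def)
qed

text \<open>
  If the maximum for 2-covers is attained by \<open>2c\<close> for a 1-cover \<open>c\<close> of maximal degree, then \<open>c\<close> is
  compatible with \<open>2c\<close>. If it is attained by the all-ones vector, for which all edges are tight,
  then every minimal 1-cover is compatible with it.
\<close>

lemma max_stable_degree_special:
  fixes E :: "'v::finite set set"
  assumes E: "simple_graph E" "no_isolated_vertex E"
    and D: "max_degree E 2 = 2 * max_degree E 1 \<or> max_degree E 2 = CARD('v)"
  shows "Max (degree_of ` stable_generators E) = max_degree E 1"
proof -
  have "tight_covers E 1 \<noteq> {}"
    using stable_generators_nonempty[OF E] by (auto simp: stable_generators_def)
  then obtain c where c: "c \<in> tight_covers E 1" "degree_of c = max_degree E 1"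
    by (rule max_degree_attained)
  have "c \<in> stable_generators E"
    using D
  proof
    assume D: "max_degree E 2 = 2 * max_degree E 1"
    have "(\<lambda>i. 2 * c i) \<in> tight_covers E 2" "(\<lambda>i. 3 * c i) \<in> tight_covers E 3"
      using tight_covers_multiple[OF c(1), of 2] tight_covers_multiple[OF c(1), of 3] by simp_all
    moreover have "(\<lambda>i. 2 * c i + c i) = (\<lambda>i. 3 * c i)"
      by auto
    moreover have "degree_of (\<lambda>i. 2 * c i) = max_degree E 2"
      using c(2) D by (simp flip: sum_distrib_left)
    ultimately show ?thesis
      unfolding stable_generators_def using c(1)
      by (intro CollectI conjI bexI[of _ "\<lambda>i. 2 * c i"]) simp_all
  next
    assume D: "max_degree E 2 = CARD('v)"
    have ones: "(\<lambda>_. 1) \<in> tight_covers E 2"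
      by (rule all_ones_tight(2)[OF E])
    have "tight E 2 (\<lambda>_. 1) i j" if "tight E 1 c i j" for i j
      using that all_ones_tight(1)[OF E, of i j] by (simp add: tight_def)
    moreover have "\<forall>i. \<exists>j. tight E 1 c i j"
      using c(1) by (simp add: tight_covers_def)
    ultimately have "\<forall>i. \<exists>j. tight E 2 (\<lambda>_. 1) i j \<and> tight E 1 c i j"
      by blast
    then have "(\<lambda>i. 1 + c i) \<in> tight_covers E (2 + 1)"
      by (rule iffD2[OF tight_covers_add_iff[OF tight_covers_imp_covers[OF ones]
            tight_covers_imp_covers[OF c(1)]]])
    then have "(\<lambda>i. 1 + c i) \<in> tight_covers E 3"
      by simp
    with ones c(1) D show ?thesis
      unfolding stable_generators_def
      by (intro CollectI conjI bexI[of _ "\<lambda>_. 1"]) simp_all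
  qed
  then show ?thesis
    using c(2) by (rule max_stable_degree_eq)
qed

theorem theorem4p13:
  fixes E :: "'v::finite set set"
    and J :: "('v, 'k::field) mpoly set"
    and M :: "('v, 'k) mpoly set"
    and e :: nat
  assumes "simple_graph E"
    and "no_isolated_vertex E"
    and J: "J = cover_ideal E"
    and M: "M = {m2 \<in> min_gens J. \<exists>m1 \<in> min_gens (symbolic_power mpoly_ring J 2).
                   real (total_degree m1) = 2 * delta E \<and>
                   m1 * m2 \<in> min_gens (symbolic_power mpoly_ring J 3)}"
    and e: "e = Max (total_degree ` M)"
  shows "(\<forall>s\<ge>1. real (omega (symbolic_power mpoly_ring J (2 * s))) = delta E * (2 * real s)) \<and>
    M \<noteq> {} \<and>
    (\<forall>s. int s \<ge> int (omega J) - int e \<longrightarrow>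
       real (omega (symbolic_power mpoly_ring J (2 * s + 1))) = delta E * (2 * real s) + real e) \<and>
    (delta E = real (omega J) \<or> delta E = real CARD('v) / 2 \<longrightarrow>
       e = omega J \<and>
       (\<forall>s. real (omega (symbolic_power mpoly_ring J (2 * s + 1))) =
          delta E * (2 * real s) + real (omega J)))"
proof -
  note E = assms(1,2)
  note omega = omega_eq_max_degree[OF E, where 'k = 'k, folded J]
  have M_eq: "M = exp_monomial ` stable_generators E"
    unfolding M J by (rule stable_generators_image[OF E])
  have nonempty: "M \<noteq> {}"
    using stable_generators_nonempty[OF E] M_eq by simp
  have e_eq: "e = Max (degree_of ` stable_generators E)"
    by (simp only: e M_eq image_image total_degree_exp_monomial)
  have delta: "real (max_degree E 2) = 2 * delta E"
    by (rule delta_eq[OF E])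
  have ne2: "tight_covers E 2 \<noteq> {}"
    using all_ones_tight(2)[OF E] by blast
  have even: "real (omega (symbolic_power mpoly_ring J (2 * s))) = delta E * (2 * real s)" for s
    by (simp add: omega max_degree_even[OF ne2] delta)
  have odd: "real (omega (symbolic_power mpoly_ring J (2 * s + 1))) = delta E * (2 * real s) + real e"
    if "int s \<ge> int (omega J) - int e" for s
  proof -
    have "max_degree E 1 \<le> e + s"
      using that by (simp add: omega)
    then have "max_degree E (2 * s + 1) = s * max_degree E 2 + e"
      by (rule max_degree_odd[OF stable_generators_nonempty[OF E] e_eq])
    then show ?thesis
      by (simp add: omega delta)
  qed
  have special: "e = omega J" if "delta E = real (omega J) \<or> delta E = real CARD('v) / 2"
  proof -
    have "real (max_degree E 2) = real (2 * max_degree E 1) \<or> real (max_degree E 2) = real CARD('v)"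
      using that by (auto simp: delta omega)
    then have "max_degree E 2 = 2 * max_degree E 1 \<or> max_degree E 2 = CARD('v)"
      by (simp only: of_nat_eq_iff)
    from max_stable_degree_special[OF E this] show ?thesis
      by (simp only: e_eq omega)
  qed
  show ?thesis
    using even nonempty odd special by auto
qed

end
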